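(* For each integer $n\ge3$, the Schrödinger operator $-\Delta+Q_{n,0}(0,z,\bar z)$ on $L^2(\mathbb{R}^2)$ has a negative bound state (that is, a negative eigenvalue), where $$Q_{n,0}(0,z,\bar z)=-8\,\partial_z\partial_{\bar z}\log\big(1+|z|^{2n}\big)=-\frac{8n^2|z|^{2(n-1)}}{(1+|z|^{2n})^2}.$$
   Context: Here $z=x+iy\in\mathbb{C}\cong\mathbb{R}^2$, $\partial_z=\frac12(\partial_x-i\partial_y)$, $\partial_{\bar z}=\frac12(\partial_x+i\partial_y)$ and $\Delta=\partial_x^2+\partial_y^2$. *)

theory Defs
  imports "HOL-Analysis.Analysis"
begin

text \<open>
  The plane is identified with \<open>\<complex>\<close>, and \<open>lborel :: complex measure\<close> is two-dimensional
  Lebesgue measure (on Borel sets). Elements of \<open>L\<^sup>2\<close> are represented by Borel functions,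
  and equality in \<open>L\<^sup>2\<close> is equality almost everywhere.
\<close>

definition pderiv_dir :: "complex \<Rightarrow> (complex \<Rightarrow> complex) \<Rightarrow> complex \<Rightarrow> complex" where
  "pderiv_dir v f z = vector_derivative (\<lambda>t::real. f (z + t *\<^sub>R v)) (at 0)"

abbreviation dx :: "(complex \<Rightarrow> complex) \<Rightarrow> complex \<Rightarrow> complex" where
  "dx \<equiv> pderiv_dir 1"

abbreviation dy :: "(complex \<Rightarrow> complex) \<Rightarrow> complex \<Rightarrow> complex" where
  "dy \<equiv> pderiv_dir \<i>"

definition dz :: "(complex \<Rightarrow> complex) \<Rightarrow> complex \<Rightarrow> complex" where
  "dz f z = (dx f z - \<i> * dy f z) / 2"

definition dzbar :: "(complex \<Rightarrow> complex) \<Rightarrow> complex \<Rightarrow> complex" where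
  "dzbar f z = (dx f z + \<i> * dy f z) / 2"

definition laplacian :: "(complex \<Rightarrow> complex) \<Rightarrow> complex \<Rightarrow> complex" where
  "laplacian f z = dx (dx f) z + dy (dy f) z"

text \<open>Differentiability below is real (Frechet) differentiability on the plane.\<close>

fun C_diff :: "nat \<Rightarrow> (complex \<Rightarrow> complex) \<Rightarrow> bool" where
  "C_diff 0 f \<longleftrightarrow> continuous_on UNIV f"
| "C_diff (Suc k) f \<longleftrightarrow> f differentiable_on UNIV \<and> C_diff k (dx f) \<and> C_diff k (dy f)"

definition test_function :: "(complex \<Rightarrow> complex) \<Rightarrow> bool" where
  "test_function \<phi> \<longleftrightarrow> (\<forall>k. C_diff k \<phi>) \<and> compact (closure {z. \<phi> z \<noteq> 0})"

definition L2 :: "(complex \<Rightarrow> complex) set" where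
  "L2 = {u \<in> borel_measurable lborel. integrable lborel (\<lambda>z. (cmod (u z))\<^sup>2)}"

definition weak_pderiv :: "complex \<Rightarrow> (complex \<Rightarrow> complex) \<Rightarrow> (complex \<Rightarrow> complex) \<Rightarrow> bool" where
  "weak_pderiv v u g \<longleftrightarrow>
     (\<forall>\<phi>. test_function \<phi> \<longrightarrow>
        (LINT z|lborel. u z * pderiv_dir v \<phi> z) = - (LINT z|lborel. g z * \<phi> z))"

definition weak_laplacian :: "(complex \<Rightarrow> complex) \<Rightarrow> (complex \<Rightarrow> complex) \<Rightarrow> bool" where
  "weak_laplacian u g \<longleftrightarrow>
     (\<forall>\<phi>. test_function \<phi> \<longrightarrow>
        (LINT z|lborel. u z * laplacian \<phi> z) = (LINT z|lborel. g z * \<phi> z))"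

text \<open>The Sobolev space \<open>H\<^sup>k\<close>: all weak partial derivatives of order at most \<open>k\<close> are in \<open>L\<^sup>2\<close>.\<close>

fun sobolev_H :: "nat \<Rightarrow> (complex \<Rightarrow> complex) set" where
  "sobolev_H 0 = L2"
| "sobolev_H (Suc k) =
     {u \<in> L2. (\<exists>g \<in> sobolev_H k. weak_pderiv 1 u g) \<and> (\<exists>g \<in> sobolev_H k. weak_pderiv \<i> u g)}"

text \<open>
  The graph of the operator \<open>-\<Delta> + V\<close> on \<open>L\<^sup>2\<close> with domain \<open>H\<^sup>2\<close>; this is its self-adjoint
  realisation when \<open>V\<close> is bounded, measurable and real-valued. The potential is given the
  type \<open>complex \<Rightarrow> complex\<close> because it will be written with Wirtinger derivatives.
\<close>

definition schrodinger ::
  "(complex \<Rightarrow> complex) \<Rightarrow> (complex \<Rightarrow> complex) \<Rightarrow> (complex \<Rightarrow> complex) \<Rightarrow> bool" where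
  "schrodinger V u w \<longleftrightarrow>
     u \<in> sobolev_H 2 \<and> w \<in> L2 \<and>
     (\<exists>g \<in> L2. weak_laplacian u g \<and> (AE z in lborel. w z = - g z + V z * u z))"

definition eigenvalue ::
  "((complex \<Rightarrow> complex) \<Rightarrow> (complex \<Rightarrow> complex) \<Rightarrow> bool) \<Rightarrow> complex \<Rightarrow> bool" where
  "eigenvalue A l \<longleftrightarrow> (\<exists>u. \<not> (AE z in lborel. u z = 0) \<and> A u (\<lambda>z. l * u z))"

definition Q_n0 :: "nat \<Rightarrow> complex \<Rightarrow> complex" where
  "Q_n0 n z = - 8 * dz (dzbar (\<lambda>w. complex_of_real (ln (1 + cmod w ^ (2 * n))))) z"

end

theory Submission
  imports Defs
begin

text \<open>
  In the variable \<open>s = |z|\<^sup>2\<close>, a radial eigenfunction \<open>f (|z|\<^sup>2)\<close> with eigenvalue \<open>-4 l\<close> satisfies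
  \<open>(s f')' = (l - v) f\<close> with \<open>v = 2 n\<^sup>2 s\<^bsup>n-1\<^esup> / (1 + s\<^sup>n)\<^sup>2\<close>. Let \<open>f l\<close> be its regular solution with
  \<open>f l 0 = 1\<close>. At \<open>l = 0\<close> it is \<open>(1 - s\<^sup>n) / (1 + s\<^sup>n)\<close>, which changes sign, whereas it is
  positive for large \<open>l\<close>. At the supremum of the \<open>l\<close> for which \<open>f l\<close> takes negative values, \<open>f l\<close>
  is positive and, by continuity in \<open>l\<close>, eventually nonincreasing, because a solution that increases
  where \<open>v < l\<close> stays positive for ever. Such a solution decays faster than any power of \<open>s\<close>, so
  that \<open>f (|z|\<^sup>2)\<close> is a classical solution in \<open>H\<^sup>2\<close>.
\<close>

section \<open>Averages along rays\<close>

text \<open>The zero-energy solution comes from the Liouville equation: away from the origin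
  \<open>ln (8 n^2 |z|^(2n-2) / (1 + |z|^(2n))^2)\<close> solves -\<Delta>u = e^u, the well is the
  linearisation there, and differentiating the solutions with |z|^(2n) scaled by a parameter gives
  (1 - s^n) / (1 + s^n). It tends to -1, so it is not square integrable; its sign change is what
  matters. No spectral theory enters: shooting yields an explicit C^2 function, for which H^2 and
  the eigenvalue equation follow by differentiation and integration by parts. The factor 4 arises
  from \<Delta>(g(|z|^2)) = 4 (s g')'. The obstacle is the singular endpoint s = 0, where f' = (1/s)
  times the integral of (l - v) f over [0, s]. Rescaled to the fixed interval [0, 1], this mean is
  \<open>avg\<close>: it takes the value of the integrand at 0 and depends continuously on s and on
  the energy, so regularity at 0 is built into the integral equation.\<close>

definition avg :: "(real \<Rightarrow> real) \<Rightarrow> real \<Rightarrow> real" where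
  "avg g s = integral {0..1} (\<lambda>t. g (s * t))"

lemma continuous_on_rescale:
  fixes g :: "real \<Rightarrow> real"
  assumes "continuous_on {0..} g" "0 \<le> s"
  shows "continuous_on {0..1} (\<lambda>t. g (s * t))"
  by (rule continuous_on_compose2[OF assms(1)]) (use assms(2) in \<open>auto intro!: continuous_intros\<close>)

lemma avg_integrable:
  fixes g :: "real \<Rightarrow> real"
  assumes "continuous_on {0..} g" "0 \<le> s"
  shows "(\<lambda>t. g (s * t)) integrable_on {0..1::real}"
  by (rule integrable_continuous_real[OF continuous_on_rescale[OF assms]])

text \<open>The parameter \<open>l\<close> later plays the role of the energy; joint continuity is
  what the compactness arguments in \<open>critical_energy\<close> consume.\<close>

lemma avg_continuous_on_param:
  fixes g :: "'a::topological_space \<Rightarrow> real \<Rightarrow> real"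
  assumes "continuous_on (A \<times> {0..}) (\<lambda>(l, s). g l s)"
  shows "continuous_on (A \<times> {0..}) (\<lambda>(l, s). avg (g l) s)"
proof -
  have "continuous_on ((A \<times> {0..}) \<times> cbox 0 1) (\<lambda>(x, t). g (fst x) (snd x * t))"
    unfolding split_beta
    by (rule continuous_on_compose2[OF assms, of _ "\<lambda>y. (fst (fst y), snd (fst y) * snd y)",
          unfolded split_beta fst_conv snd_conv])
       (auto intro!: continuous_intros)
  from integral_continuous_on_param[OF this] show ?thesis
    by (simp add: avg_def split_beta)
qed

lemma continuous_on_slice:
  assumes "continuous_on (A \<times> B) (\<lambda>(l, s). g l s)" "l \<in> A"
  shows "continuous_on B (g l)"
proof -
  have "continuous_on B (\<lambda>s. (l, s))" by (intro continuous_intros)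
  from continuous_on_compose2[OF assms(1) this] assms(2) show ?thesis by auto
qed

lemma avg_continuous_on:
  assumes "continuous_on {0..} g"
  shows "continuous_on {0..} (avg g)"
proof -
  \<comment> \<open>A dummy real parameter reduces the claim to the parametric version.\<close>
  have "continuous_on (UNIV \<times> {0..}) (\<lambda>(l::real, s). g s)"
    unfolding split_beta
    by (rule continuous_on_compose2[OF assms]) (auto intro!: continuous_intros)
  from continuous_on_slice[OF avg_continuous_on_param[OF this]] show ?thesis by auto
qed

lemma avg_nonneg:
  assumes "continuous_on {0..} g" "0 \<le> s" "\<And>t. 0 \<le> t \<Longrightarrow> 0 \<le> g t"
  shows "0 \<le> avg g s"
  unfolding avg_def
  by (rule integral_nonneg) (use assms in \<open>auto intro: avg_integrable\<close>)

lemma avg_diff: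
  assumes "continuous_on {0..} g" "continuous_on {0..} h" "0 \<le> s"
  shows "avg (\<lambda>t. g t - h t) s = avg g s - avg h s"
  unfolding avg_def
  by (rule integral_diff) (use assms in \<open>auto intro: avg_integrable\<close>)

text \<open>Integrating t^j over [0, 1] produces the factor 1 / (j + 1). Repeated use of this factor
  builds the factorials that make the Neumann series converge.\<close>

lemma avg_power_bound:
  assumes g: "continuous_on {0..} g" and s: "0 \<le> s"
    and b: "\<And>t. 0 \<le> t \<Longrightarrow> t \<le> s \<Longrightarrow> \<bar>g t\<bar> \<le> B * t ^ j"
  shows "\<bar>avg g s\<bar> \<le> B * s ^ j / (j + 1)"
proof -
  have *: "((\<lambda>t. B * s ^ j * t ^ j) has_integral (B * s ^ j / (j + 1))) {0..1}"
  proof -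
    have "((\<lambda>t. B * s ^ j * t ^ j) has_integral
       ((B * s ^ j / (j + 1)) * 1 ^ (j+1) - (B * s ^ j / (j + 1)) * 0 ^ (j+1))) {0..1}"
    proof (rule fundamental_theorem_of_calculus)
      fix t :: real
      have "((\<lambda>t. B * s ^ j / (j + 1) * t ^ (j + 1)) has_real_derivative
          B * s ^ j / (j + 1) * ((j + 1) * t ^ j)) (at t within {0..1})"
        using DERIV_cmult[OF DERIV_pow[of "Suc j" t "{0..1}"], where c = "B * s ^ j / (j + 1)"]
        by (simp add: add.commute)
      then show "((\<lambda>t. B * s ^ j / (j + 1) * t ^ (j + 1)) has_vector_derivative
          B * s ^ j * t ^ j) (at t within {0..1})"
        by (simp add: has_real_derivative_iff_has_vector_derivative mult_ac)
    qed simp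
    then show ?thesis by simp
  qed
  have "\<bar>avg g s\<bar> \<le> integral {0..1} (\<lambda>t. B * s ^ j * t ^ j)"
    unfolding avg_def
  proof (rule integral_norm_bound_integral[where 'a = real, unfolded real_norm_def])
    show "(\<lambda>t. g (s * t)) integrable_on {0..1}" by (rule avg_integrable[OF g s])
    show "(\<lambda>t. B * s ^ j * t ^ j) integrable_on {0..1}" using * by blast
    show "\<bar>g (s * t)\<bar> \<le> B * s ^ j * t ^ j" if "t \<in> {0..1}" for t
      using b[of "s * t"] that s mult_left_le[of t s] by (auto simp: power_mult_distrib mult_ac)
  qed
  also have "\<dots> = B * s ^ j / (j + 1)" using * by (rule integral_unique)
  finally show ?thesis .
qed

lemma avg_FTC:
  assumes G: "\<And>x. 0 \<le> x \<Longrightarrow> (G has_real_derivative g x) (at x within {0..})" and s: "0 \<le> s"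
  shows "s * avg g s = G s - G 0"
proof -
  have "((\<lambda>t. s * g (s * t)) has_integral (G (s * 1) - G (s * 0))) {0..1}"
  proof (rule fundamental_theorem_of_calculus)
    fix t :: real assume t: "t \<in> {0..1}"
    have "((\<lambda>t. G (s * t)) has_real_derivative g (s * t) * s) (at t within {0..1})"
    proof (rule DERIV_image_chain[of G _ "\<lambda>t. s * t", unfolded o_def])
      show "(G has_real_derivative g (s * t)) (at (s * t) within (*) s ` {0..1})"
        by (rule has_field_derivative_subset[OF G]) (use s t in auto)
      show "((*) s has_real_derivative s) (at t within {0..1})"
        by (auto intro!: derivative_eq_intros)
    qed
    then show "((\<lambda>t. G (s * t)) has_vector_derivative s * g (s * t)) (at t within {0..1})"
      by (simp add: has_real_derivative_iff_has_vector_derivative mult.commute)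
  qed simp
  then show ?thesis
    by (simp add: avg_def integral_unique flip: integral_mult_right)
qed

lemma avg_deriv:
  assumes g: "continuous_on {0..} g" and s: "0 \<le> s"
  shows "((\<lambda>x. x * avg g x) has_real_derivative g s) (at s within {0..})"
proof -
  define G where "G x = integral {0..x} g" for x
  have G: "(G has_real_derivative g x) (at x within {0..})" if "0 \<le> x" for x
  proof -
    have "(G has_real_derivative g x) (at x within {0..x+1})"
      unfolding G_def
      by (rule integral_has_real_derivative) (use that in \<open>auto intro: continuous_on_subset[OF g]\<close>)
    also have "at x within {0..x+1} = at x within {0..}"
      by (rule at_within_nhd[of _ "{..<x+1}"]) auto
    finally show ?thesis .
  qed
  have "((\<lambda>x. G x - G 0) has_real_derivative g s - 0) (at s within {0..})"
    by (intro DERIV_diff G s DERIV_const)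
  then show ?thesis
    using has_field_derivative_transform_within[of _ _ s "{0..}" 1 "\<lambda>x. x * avg g x"] s avg_FTC[OF G]
    by auto
qed


text \<open>Differentiation under the integral gives q(s) as the integral of t g'(s t), continuous
  up to s = 0. Applied to f' = avg (w f), it yields the second derivative of the solution at the
  singular endpoint too; this is why the well has to be C^1.\<close>

lemma avg_has_derivative:
  assumes g: "\<And>x. 0 \<le> x \<Longrightarrow> (g has_real_derivative g' x) (at x within {0..})"
    and g': "continuous_on {0..} g'"
  shows "\<exists>q. continuous_on {0..} q \<and>
    (\<forall>s\<ge>0. (avg g has_real_derivative q s) (at s within {0..}) \<and> avg g s + s * q s = g s)"
proof -
  have gc: "continuous_on {0..} g"
    by (rule DERIV_continuous_on[of _ _ g']) (use g in auto)
  have c: "continuous_on ({0..} \<times> cbox 0 1) (\<lambda>(s, t). g' (s * t) * t)"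
    unfolding split_beta
    by (intro continuous_intros continuous_on_compose2[OF g']) auto
  define q where "q s = integral (cbox 0 1) (\<lambda>t. g' (s * t) * t)" for s
  have "continuous_on {0..} q"
    unfolding q_def by (rule integral_continuous_on_param[OF c])
  moreover have "(avg g has_real_derivative q s) (at s within {0..})" if s: "0 \<le> s" for s
    unfolding q_def avg_def[abs_def] cbox_interval[symmetric]
  proof (rule leibniz_rule_field_derivative[OF _ _ c])
    show "((\<lambda>x. g (x * t)) has_real_derivative g' (x * t) * t) (at x within {0..})"
      if "x \<in> {0..}" "t \<in> cbox 0 1" for x t :: real
    proof (rule DERIV_image_chain[of g _ "\<lambda>x. x * t", unfolded o_def])
      show "(g has_real_derivative g' (x * t)) (at (x * t) within (\<lambda>x. x * t) ` {0..})"
        by (rule has_field_derivative_subset[OF g]) (use that in auto)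
    qed (auto intro!: derivative_eq_intros)
    show "(\<lambda>t. g (x * t)) integrable_on cbox 0 1" if "x \<in> {0..}" for x :: real
      using avg_integrable[OF gc, of x] that by simp
  qed (use s in \<open>auto\<close>)
  moreover have "avg g s + s * q s = g s" if s: "0 \<le> s" for s
  proof -
    \<comment> \<open>The integrand is the t-derivative of t g(s t), so the identity is the
      fundamental theorem on [0, 1].\<close>
    have "((\<lambda>t. g (s * t) + s * (g' (s * t) * t)) has_integral (1 * g (s * 1) - 0 * g (s * 0))) {0..1}"
    proof (rule fundamental_theorem_of_calculus)
      fix t :: real assume t: "t \<in> {0..1}"
      have "((\<lambda>t. g (s * t)) has_real_derivative g' (s * t) * s) (at t within {0..1})"
      proof (rule DERIV_image_chain[of g _ "\<lambda>t. s * t", unfolded o_def])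
        show "(g has_real_derivative g' (s * t)) (at (s * t) within (*) s ` {0..1})"
          by (rule has_field_derivative_subset[OF g]) (use s t in auto)
      qed (auto intro!: derivative_eq_intros)
      from DERIV_mult[OF DERIV_ident this]
      show "((\<lambda>t. t * g (s * t)) has_vector_derivative g (s * t) + s * (g' (s * t) * t)) (at t within {0..1})"
        by (simp add: has_real_derivative_iff_has_vector_derivative algebra_simps)
    qed simp
    then have "integral {0..1} (\<lambda>t. g (s * t) + s * (g' (s * t) * t)) = g s"
      by (simp add: integral_unique)
    moreover have "integral {0..1} (\<lambda>t. g (s * t) + s * (g' (s * t) * t)) = avg g s + s * q s"
    proof -
      have "(\<lambda>t. g' (s * t) * t) integrable_on {0..1}"
        by (intro integrable_continuous_real continuous_intros continuous_on_rescale g' s)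
      then show ?thesis
        unfolding avg_def q_def cbox_interval
        by (subst integral_add)
          (use avg_integrable[OF gc s] in \<open>auto intro: integrable_on_mult_right\<close>)
    qed
    ultimately show ?thesis by simp
  qed
  ultimately show ?thesis by blast
qed

section \<open>The Volterra equation\<close>

text \<open>\<open>f = 1 + volterra w f\<close> is the integrated form of \<open>(s f')' = w f\<close> with \<open>f 0 = 1\<close> and \<open>f\<close> regular at \<open>0\<close>.\<close>

definition volterra :: "(real \<Rightarrow> real) \<Rightarrow> (real \<Rightarrow> real) \<Rightarrow> real \<Rightarrow> real" where
  "volterra w g s = s * avg (avg (\<lambda>t. w t * g t)) s"

lemma volterra_continuous_on_param:
  fixes w g :: "'a::topological_space \<Rightarrow> real \<Rightarrow> real"
  assumes "continuous_on (A \<times> {0..}) (\<lambda>(l, s). w l s)" "continuous_on (A \<times> {0..}) (\<lambda>(l, s). g l s)"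
  shows "continuous_on (A \<times> {0..}) (\<lambda>(l, s). volterra (w l) (g l) s)"
proof -
  have "continuous_on (A \<times> {0..}) (\<lambda>(l, s). w l s * g l s)"
    using assms by (auto simp: split_beta intro!: continuous_intros)
  from avg_continuous_on_param[OF avg_continuous_on_param[OF this]] show ?thesis
    by (auto simp: volterra_def split_beta intro!: continuous_intros)
qed

lemma volterra_continuous_on:
  assumes "continuous_on {0..} w" "continuous_on {0..} g"
  shows "continuous_on {0..} (volterra w g)"
  unfolding volterra_def[abs_def]
  by (intro continuous_intros avg_continuous_on assms)

lemma volterra_nonneg:
  assumes "continuous_on {0..} w" "continuous_on {0..} g" "0 \<le> s"
    and "\<And>t. 0 \<le> t \<Longrightarrow> 0 \<le> w t" "\<And>t. 0 \<le> t \<Longrightarrow> 0 \<le> g t"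
  shows "0 \<le> volterra w g s"
  unfolding volterra_def
  by (intro mult_nonneg_nonneg avg_nonneg avg_continuous_on continuous_intros assms)

lemma volterra_diff:
  assumes w: "continuous_on {0..} w" and g: "continuous_on {0..} g" and h: "continuous_on {0..} h"
    and s: "0 \<le> s"
  shows "volterra w (\<lambda>t. g t - h t) s = volterra w g s - volterra w h s"
proof -
  have c: "continuous_on {0..} (\<lambda>t. w t * g t)" "continuous_on {0..} (\<lambda>t. w t * h t)"
    by (intro continuous_intros w g h)+
  have "avg (avg (\<lambda>t. w t * (g t - h t))) s =
      avg (\<lambda>s. avg (\<lambda>t. w t * g t) s - avg (\<lambda>t. w t * h t) s) s"
    unfolding avg_def[of "avg _"] avg_def[of "\<lambda>s. avg _ s - _ s"]
    by (rule integral_cong) (use s in \<open>auto simp: right_diff_distrib avg_diff[OF c, symmetric]\<close>)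
  also have "\<dots> = avg (avg (\<lambda>t. w t * g t)) s - avg (avg (\<lambda>t. w t * h t)) s"
    by (rule avg_diff[OF avg_continuous_on avg_continuous_on]) (use c s in auto)
  finally show ?thesis by (simp add: volterra_def right_diff_distrib[of s])
qed

text \<open>Each of the two averages could contribute 1 / (j + 1). The inner one is bounded by 1 and
  only the outer one is kept, which is already enough for an exponential majorant.\<close>

lemma volterra_bound:
  assumes w: "continuous_on {0..} w" and g: "continuous_on {0..} g" and s: "0 \<le> s"
    and C: "\<And>t. 0 \<le> t \<Longrightarrow> \<bar>w t\<bar> \<le> C"
    and B: "\<And>t. 0 \<le> t \<Longrightarrow> t \<le> s \<Longrightarrow> \<bar>g t\<bar> \<le> B * t ^ j" and B0: "0 \<le> B"
  shows "\<bar>volterra w g s\<bar> \<le> B * C * s ^ Suc j / Suc j"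
proof -
  have c: "continuous_on {0..} (\<lambda>t. w t * g t)" by (intro continuous_intros w g)
  have C0: "0 \<le> C" using C[of 0] by linarith
  have 1: "\<bar>avg (\<lambda>t. w t * g t) t\<bar> \<le> B * C * t ^ j" if t: "0 \<le> t" "t \<le> s" for t
  proof -
    have "\<bar>avg (\<lambda>t. w t * g t) t\<bar> \<le> (B * C) * t ^ j / (j + 1)"
    proof (rule avg_power_bound[OF c t(1)])
      fix r assume r: "0 \<le> r" "r \<le> t"
      have "\<bar>w r\<bar> * \<bar>g r\<bar> \<le> C * (B * r ^ j)"
        by (intro mult_mono C B) (use r t C0 in auto)
      then show "\<bar>w r * g r\<bar> \<le> (B * C) * r ^ j" by (simp add: abs_mult mult_ac)
    qed
    also have "\<dots> \<le> B * C * t ^ j"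
      using B0 C0 t by (simp add: divide_le_eq mult_left_mono distrib_left)
    finally show ?thesis .
  qed
  have "\<bar>avg (avg (\<lambda>t. w t * g t)) s\<bar> \<le> B * C * s ^ j / (j + 1)"
    by (rule avg_power_bound[OF avg_continuous_on[OF c] s 1])
  then have "s * \<bar>avg (avg (\<lambda>t. w t * g t)) s\<bar> \<le> s * (B * C * s ^ j / (j + 1))"
    by (intro mult_left_mono s)
  then show ?thesis using s by (simp add: volterra_def abs_mult mult_ac add.commute)
qed

text \<open>Iterating the equation improves a bound B on [0, s] to B (C s)^j / j! for every j, and
  this tends to 0.\<close>

lemma volterra_unique:
  assumes w: "continuous_on {0..} w" and d: "continuous_on {0..} d" and s: "0 \<le> s"
    and C: "\<And>t. 0 \<le> t \<Longrightarrow> \<bar>w t\<bar> \<le> C"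
    and eq: "\<And>t. 0 \<le> t \<Longrightarrow> d t = volterra w d t"
  shows "d s = 0"
proof -
  have "compact (d ` {0..s})"
    by (intro compact_continuous_image continuous_on_subset[OF d]) auto
  then obtain B where B: "\<And>t. t \<in> {0..s} \<Longrightarrow> \<bar>d t\<bar> \<le> B"
    using compact_imp_bounded[of "d ` {0..s}"] by (force simp: bounded_iff)
  have B0: "0 \<le> B" using B[of 0] s by fastforce
  have C0: "0 \<le> C" using C[of 0] by linarith
  have it: "\<bar>d t\<bar> \<le> B * C ^ j / fact j * t ^ j" if "0 \<le> t" "t \<le> s" for t j
    using that
  proof (induction j arbitrary: t)
    case 0
    then show ?case using B by auto
  next
    case (Suc j)
    have "\<bar>volterra w d t\<bar> \<le> (B * C ^ j / fact j) * C * t ^ Suc j / Suc j"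
      by (rule volterra_bound[OF w d]) (use Suc C B0 C0 in auto)
    also have "\<dots> = B * C ^ Suc j / fact (Suc j) * t ^ Suc j"
      by (simp add: field_simps)
    finally show ?case using eq[of t] Suc.prems by simp
  qed
  have "(\<lambda>j. B * (inverse (fact j) * (C * s) ^ j)) \<longlonglongrightarrow> B * 0"
    by (intro tendsto_intros summable_LIMSEQ_zero summable_exp)
  moreover have "\<bar>d s\<bar> \<le> B * (inverse (fact j) * (C * s) ^ j)" for j
    using it[of s j] s by (simp add: field_simps power_mult_distrib)
  ultimately have "\<bar>d s\<bar> \<le> B * 0"
    by (intro LIMSEQ_le_const) auto
  then show ?thesis by simp
qed

section \<open>The Neumann series of the Volterra operator\<close>

primrec volterra_iter :: "(real \<Rightarrow> real) \<Rightarrow> nat \<Rightarrow> real \<Rightarrow> real" where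
  "volterra_iter w 0 = (\<lambda>s. 1)"
| "volterra_iter w (Suc j) = volterra w (volterra_iter w j)"

definition volterra_solution :: "(real \<Rightarrow> real) \<Rightarrow> real \<Rightarrow> real" where
  "volterra_solution w s = (\<Sum>j. volterra_iter w j s)"

lemma volterra_iter_continuous_on:
  assumes "continuous_on {0..} w"
  shows "continuous_on {0..} (volterra_iter w j)"
  by (induction j) (auto intro: volterra_continuous_on assms)

lemma volterra_iter_continuous_on_param:
  fixes w :: "'a::topological_space \<Rightarrow> real \<Rightarrow> real"
  assumes "continuous_on (A \<times> {0..}) (\<lambda>(l, s). w l s)"
  shows "continuous_on (A \<times> {0..}) (\<lambda>(l, s). volterra_iter (w l) j s)"
proof (induction j)
  case (Suc j)
  from volterra_continuous_on_param[OF assms Suc] show ?case by simp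
qed (simp add: split_beta)

lemma volterra_iter_bound:
  assumes w: "continuous_on {0..} w" and s: "0 \<le> s"
    and C: "\<And>t. 0 \<le> t \<Longrightarrow> \<bar>w t\<bar> \<le> C"
  shows "\<bar>volterra_iter w j s\<bar> \<le> C ^ j / fact j * s ^ j"
  using s
proof (induction j arbitrary: s)
  case (Suc j)
  have C0: "0 \<le> C" using C[of 0] by linarith
  have "\<bar>volterra w (volterra_iter w j) s\<bar> \<le> (C ^ j / fact j) * C * s ^ Suc j / Suc j"
    by (rule volterra_bound[OF w volterra_iter_continuous_on[OF w]]) (use Suc C C0 in auto)
  also have "\<dots> = C ^ Suc j / fact (Suc j) * s ^ Suc j"
    by (simp add: field_simps)
  finally show ?case by simp
qed simp

text \<open>The majorant (C S)^j / j! involves the weight only through the common bound C, so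
  convergence is uniform in the parameter as well as in s.\<close>

lemma volterra_iter_uniform_limit:
  fixes w :: "'a \<Rightarrow> real \<Rightarrow> real"
  assumes w: "\<And>l. l \<in> A \<Longrightarrow> continuous_on {0..} (w l)"
    and C: "\<And>l t. l \<in> A \<Longrightarrow> 0 \<le> t \<Longrightarrow> \<bar>w l t\<bar> \<le> C"
  shows "uniform_limit (A \<times> {0..S}) (\<lambda>N (l, s). \<Sum>j<N. volterra_iter (w l) j s)
           (\<lambda>(l, s). volterra_solution (w l) s) sequentially"
  unfolding volterra_solution_def split_beta
proof (rule Weierstrass_m_test)
  show "summable (\<lambda>j. inverse (fact j) * (C * S) ^ j)" by (rule summable_exp)
  fix j x assume x: "x \<in> A \<times> {0..S}"
  then obtain l s where [simp]: "x = (l, s)" and l: "l \<in> A" and s: "0 \<le> s" "s \<le> S" by auto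
  have C0: "0 \<le> C" using C[OF l, of 0] by linarith
  have "\<bar>volterra_iter (w l) j s\<bar> \<le> C ^ j / fact j * s ^ j"
    by (rule volterra_iter_bound[OF w[OF l] s(1) C[OF l]])
  also have "\<dots> \<le> C ^ j / fact j * S ^ j"
    by (intro mult_left_mono power_mono s) (use C0 in auto)
  finally show "norm (volterra_iter (w (fst x)) j (snd x)) \<le> inverse (fact j) * (C * S) ^ j"
    by (simp add: field_simps power_mult_distrib)
qed

text \<open>Convergence is uniform only for bounded s. Continuity is local, so the strips
  \<open>A \<times> {0..S}\<close> suffice: near (l, s) the strip with S = s + 1 has the same
  neighbourhoods as the whole domain.\<close>

lemma volterra_solution_continuous_on_param:
  fixes w :: "'a::metric_space \<Rightarrow> real \<Rightarrow> real"
  assumes w: "continuous_on (A \<times> {0..}) (\<lambda>(l, s). w l s)"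
    and C: "\<And>l t. l \<in> A \<Longrightarrow> 0 \<le> t \<Longrightarrow> \<bar>w l t\<bar> \<le> C"
  shows "continuous_on (A \<times> {0..}) (\<lambda>(l, s). volterra_solution (w l) s)"
proof -
  have c: "continuous_on (A \<times> {0..S}) (\<lambda>(l, s). volterra_solution (w l) s)" for S
  proof (rule uniform_limit_theorem[OF _ volterra_iter_uniform_limit])
    show "\<forall>\<^sub>F N in sequentially. continuous_on (A \<times> {0..S})
        (\<lambda>(l, s). \<Sum>j<N. volterra_iter (w l) j s)"
      unfolding split_beta
      by (intro always_eventually allI continuous_on_sum
            continuous_on_subset[OF volterra_iter_continuous_on_param[OF w, unfolded split_beta]]) auto
  qed (use continuous_on_slice[OF w] C in auto)
  show ?thesis
    unfolding continuous_on_eq_continuous_within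
  proof
    fix x assume x: "x \<in> A \<times> {0::real..}"
    then obtain l s where [simp]: "x = (l, s)" and l: "l \<in> A" "0 \<le> s" by auto
    have "at x within A \<times> {0..s+1} = at x within A \<times> {0..}"
      by (rule at_within_nhd[of _ "UNIV \<times> {..<s+1}"]) (auto intro!: open_Times)
    with c[of "s + 1", unfolded continuous_on_eq_continuous_within, rule_format, of x] l
    show "continuous (at x within A \<times> {0..}) (\<lambda>(l, s). volterra_solution (w l) s)" by simp
  qed
qed

lemma
  assumes w: "continuous_on {0..} w" and C: "\<And>t. 0 \<le> t \<Longrightarrow> \<bar>w t\<bar> \<le> C"
  shows volterra_solution_continuous_on: "continuous_on {0..} (volterra_solution w)"
    and volterra_solution_eq: "0 \<le> s \<Longrightarrow> volterra_solution w s = 1 + volterra w (volterra_solution w) s"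
    and volterra_solution_nonneg:
      "\<lbrakk>0 \<le> s; \<And>t. 0 \<le> t \<Longrightarrow> 0 \<le> w t\<rbrakk> \<Longrightarrow> 0 \<le> volterra_solution w s"
proof -
  let ?f = "volterra_solution w"
  define F where "F N s = (\<Sum>j<N. volterra_iter w j s)" for N s
  have "continuous_on ({0::real} \<times> {0..}) (\<lambda>(l::real, s). w s)"
    unfolding split_beta by (rule continuous_on_compose2[OF w]) (auto intro!: continuous_intros)
  from continuous_on_slice[OF volterra_solution_continuous_on_param[OF this C]]
  show fc: "continuous_on {0..} ?f" by auto
  have Fc: "continuous_on {0..} (F N)" for N
    unfolding F_def[abs_def] by (intro continuous_intros volterra_iter_continuous_on w)
  have ul: "uniform_limit {0..S} F ?f sequentially" for S
  proof -
    have "uniform_limit ({0::real} \<times> {0..S}) (\<lambda>N (l, s). F N s) (\<lambda>(l, s). ?f s) sequentially"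
      unfolding F_def by (rule volterra_iter_uniform_limit) (use w C in auto)
    from uniform_limit_compose'[OF this, of "\<lambda>s. (0, s)" "{0..S}"] show ?thesis by auto
  qed
  have lim: "(\<lambda>N. F N s) \<longlonglongrightarrow> ?f s" if "0 \<le> s" for s
    by (rule tendsto_uniform_limitI[OF ul[of s]]) (use that in auto)
  \<comment> \<open>The operator shifts the partial sums by one term; letting N tend to infinity
    turns this into the integral equation.\<close>
  have vF: "volterra w (F N) s = F (Suc N) s - 1" if s: "0 \<le> s" for N s
  proof (induction N)
    case 0
    show ?case by (simp add: F_def[abs_def] volterra_def avg_def[abs_def])
  next
    case (Suc N)
    have "volterra w (F (Suc N)) s - volterra w (F N) s = volterra w (\<lambda>t. F (Suc N) t - F N t) s"
      by (rule volterra_diff[OF w Fc Fc s, symmetric])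
    also have "\<dots> = volterra_iter w (Suc N) s" by (simp add: F_def)
    also have "\<dots> = F (Suc (Suc N)) s - F (Suc N) s" by (simp add: F_def)
    finally show ?case using Suc by linarith
  qed
  show "?f s = 1 + volterra w ?f s" if s: "0 \<le> s"
  proof -
    have "(\<lambda>N. volterra w (F N) s) \<longlonglongrightarrow> volterra w ?f s"
    proof (rule LIMSEQ_I)
      fix e :: real assume e: "0 < e"
      have C0: "0 \<le> C" using C[of 0] by linarith
      \<comment> \<open>An error of e' on [0, s] is mapped to one of at most e' C s; the extra 1
        keeps the denominator positive when C s = 0.\<close>
      define e' where "e' = e / (C * s + 1)"
      have Cs: "0 \<le> C * s" using C0 s by simp
      then have e': "0 < e'" using e by (simp add: e'_def)
      from uniform_limitD[OF ul[of s] e'] obtain N0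
        where N0: "\<And>N t. N \<ge> N0 \<Longrightarrow> t \<in> {0..s} \<Longrightarrow> \<bar>F N t - ?f t\<bar> < e'"
        unfolding eventually_sequentially dist_real_def by blast
      show "\<exists>N0. \<forall>N\<ge>N0. norm (volterra w (F N) s - volterra w ?f s) < e"
      proof (intro exI[of _ N0] allI impI)
        fix N assume N: "N0 \<le> N"
        have "\<bar>volterra w (\<lambda>t. F N t - ?f t) s\<bar> \<le> e' * C * s ^ Suc 0 / Suc 0"
          by (rule volterra_bound[OF w _ s C])
            (use N0[OF N] e' in \<open>auto intro!: continuous_intros Fc fc less_imp_le\<close>)
        also have "\<dots> < e' * (C * s + 1)" using e' by (simp add: algebra_simps)
        also have "\<dots> = e" using Cs by (simp add: e'_def)
        finally show "norm (volterra w (F N) s - volterra w ?f s) < e"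
          by (simp add: volterra_diff[OF w Fc fc s])
      qed
    qed
    moreover have "(\<lambda>N. F (Suc N) s - 1) \<longlonglongrightarrow> ?f s - 1"
      by (intro tendsto_intros LIMSEQ_Suc lim s)
    ultimately have "volterra w ?f s = ?f s - 1"
      using vF[OF s] LIMSEQ_unique by auto
    then show ?thesis by simp
  qed
  show "0 \<le> ?f s" if s: "0 \<le> s" and w0: "\<And>t. 0 \<le> t \<Longrightarrow> 0 \<le> w t"
  proof (rule LIMSEQ_le_const[OF lim[OF s]])
    have "0 \<le> volterra_iter w j t" if "0 \<le> t" for j t
      using that
      by (induction j arbitrary: t)
        (auto intro: volterra_nonneg w w0 volterra_iter_continuous_on)
    with s show "\<exists>N. \<forall>n\<ge>N. 0 \<le> F n s" by (auto simp: F_def intro: sum_nonneg)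
  qed
qed

section \<open>The critical energy\<close>

lemma at_within_atLeast:
  fixes s :: real
  assumes "0 < s" shows "at s within {0..} = at s"
  by (rule at_within_interior) (use assms in auto)

text \<open>
  In the variable \<open>s = |z|\<^sup>2\<close> the equation for a radial eigenfunction \<open>g (|z|\<^sup>2)\<close> of
  \<open>-\<Delta> - 4 v (|z|\<^sup>2)\<close> with eigenvalue \<open>-4 l\<close> is \<open>(s g')' = (l - v) g\<close>.
  The function \<open>\<phi>\<close> is the regular solution at energy zero and \<open>\<psi>\<close> its derivative.
\<close>

locale attractive_well =
  fixes v v' \<phi> \<psi> :: "real \<Rightarrow> real" and B :: real
  assumes v_deriv: "\<And>s. 0 \<le> s \<Longrightarrow> (v has_real_derivative v' s) (at s within {0..})"
    and v'_cont: "continuous_on {0..} v'"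
    and v_nonneg: "\<And>s. 0 \<le> s \<Longrightarrow> 0 \<le> v s" and v_le: "\<And>s. 0 \<le> s \<Longrightarrow> v s \<le> B"
    and v_lim: "(v \<longlongrightarrow> 0) at_top"
    and \<phi>_deriv: "\<And>s. 0 \<le> s \<Longrightarrow> (\<phi> has_real_derivative \<psi> s) (at s within {0..})"
    and \<psi>_deriv: "\<And>s. 0 \<le> s \<Longrightarrow> ((\<lambda>s. s * \<psi> s) has_real_derivative - v s * \<phi> s) (at s within {0..})"
    and \<phi>_0: "\<phi> 0 = 1" and \<psi>_0: "\<psi> 0 = - v 0" and \<phi>_neg: "\<exists>s\<ge>0. \<phi> s < 0"
begin

definition w :: "real \<Rightarrow> real \<Rightarrow> real" where "w l s = l - v s"
definition f :: "real \<Rightarrow> real \<Rightarrow> real" where "f l = volterra_solution (w l)"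
text \<open>This is the derivative of \<open>f l\<close> (see \<open>f_deriv\<close>), in the form
  that remains meaningful at s = 0.\<close>

definition p :: "real \<Rightarrow> real \<Rightarrow> real" where "p l = avg (\<lambda>t. w l t * f l t)"

lemma v_cont: "continuous_on {0..} v"
  by (rule DERIV_continuous_on[of _ _ v']) (use v_deriv in auto)

lemma w_cont: "continuous_on {0..} (w l)"
  unfolding w_def[abs_def] by (intro continuous_intros v_cont)

lemma w_le: "0 \<le> s \<Longrightarrow> \<bar>l\<bar> \<le> L \<Longrightarrow> \<bar>w l s\<bar> \<le> L + B"
  using v_nonneg[of s] v_le[of s] by (auto simp: w_def)

lemma f_cont: "continuous_on {0..} (f l)"
  unfolding f_def by (rule volterra_solution_continuous_on[OF w_cont w_le]) auto

lemma p_cont: "continuous_on {0..} (p l)"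
  unfolding p_def by (intro avg_continuous_on continuous_intros w_cont f_cont)

lemma f_eq: "0 \<le> s \<Longrightarrow> f l s = 1 + s * avg (p l) s"
  using volterra_solution_eq[OF w_cont w_le[of _ l "\<bar>l\<bar>"], of s]
  by (simp add: p_def[abs_def] volterra_def flip: f_def)

lemma f_0: "f l 0 = 1"
  using f_eq[of 0 l] by simp

lemma f_deriv:
  assumes s: "0 \<le> s" shows "(f l has_real_derivative p l s) (at s within {0..})"
proof (rule has_field_derivative_transform_within[of "\<lambda>x. 1 + x * avg (p l) x" _ s "{0..}" 1])
  show "((\<lambda>x. 1 + x * avg (p l) x) has_real_derivative p l s) (at s within {0..})"
    using DERIV_add[OF DERIV_const avg_deriv[OF p_cont s]] by simp
qed (use s f_eq in auto)

lemma sp_deriv: "0 \<le> s \<Longrightarrow> ((\<lambda>s. s * p l s) has_real_derivative w l s * f l s) (at s within {0..})"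
  unfolding p_def by (rule avg_deriv) (intro continuous_intros w_cont f_cont)


lemma w_joint_cont: "continuous_on ({0..L} \<times> {0..}) (\<lambda>(l, s). w l s)"
  unfolding w_def split_beta
  by (intro continuous_intros continuous_on_compose2[OF v_cont]) auto

lemma f_joint_cont: "continuous_on ({0..L} \<times> {0..}) (\<lambda>(l, s). f l s)"
  unfolding f_def by (rule volterra_solution_continuous_on_param[OF w_joint_cont w_le]) auto

lemma p_joint_cont: "continuous_on ({0..L} \<times> {0..}) (\<lambda>(l, s). p l s)"
  unfolding p_def
  by (rule avg_continuous_on_param)
    (use w_joint_cont f_joint_cont in \<open>auto simp: split_beta intro!: continuous_intros\<close>)

lemma f_param_cont:
  assumes "0 \<le> s" shows "continuous_on {0..L} (\<lambda>l. f l s)"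
proof -
  have "continuous_on {0..L} (\<lambda>l. (l, s))" by (intro continuous_intros)
  from continuous_on_compose2[OF f_joint_cont this] assms show ?thesis by auto
qed

lemma p_param_cont:
  assumes "0 \<le> s" shows "continuous_on {0..L} (\<lambda>l. p l s)"
proof -
  have "continuous_on {0..L} (\<lambda>l. (l, s))" by (intro continuous_intros)
  from continuous_on_compose2[OF p_joint_cont this] assms show ?thesis by auto
qed

text \<open>Once l is at least the depth of the well, the weight is nonnegative, hence so is every
  term of the Neumann series.\<close>

lemma f_nonneg_large: "B \<le> l \<Longrightarrow> 0 \<le> s \<Longrightarrow> 0 \<le> f l s"
  unfolding f_def
  by (rule volterra_solution_nonneg[OF w_cont w_le]) (use v_le in \<open>force simp: w_def\<close>)+

text \<open>Integrating the two differential equations shows that \<phi> solves the same Volterra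
  equation, so uniqueness applies. At t = 0 one cannot divide by t; there the assumption on \<psi> 0
  supplies the value of the average.\<close>

lemma f_zero_energy:
  assumes s: "0 \<le> s" shows "f 0 s = \<phi> s"
proof -
  have \<phi>_cont: "continuous_on {0..} \<phi>"
    by (rule DERIV_continuous_on[of _ _ \<psi>]) (use \<phi>_deriv in auto)
  have avg\<psi>: "avg (\<lambda>t. w 0 t * \<phi> t) t = \<psi> t" if t: "0 \<le> t" for t
  proof (cases "t = 0")
    case True
    then show ?thesis by (simp add: avg_def w_def \<phi>_0 \<psi>_0)
  next
    case False
    have "t * avg (\<lambda>t. w 0 t * \<phi> t) t = t * \<psi> t - 0 * \<psi> 0"
      by (rule avg_FTC[OF _ t]) (use \<psi>_deriv in \<open>simp add: w_def\<close>)
    with False show ?thesis by simp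
  qed
  have \<phi>_eq: "\<phi> t = 1 + volterra (w 0) \<phi> t" if t: "0 \<le> t" for t
  proof -
    have "t * avg (avg (\<lambda>t. w 0 t * \<phi> t)) t = \<phi> t - \<phi> 0"
      by (rule avg_FTC[OF _ t]) (use \<phi>_deriv avg\<psi> in simp)
    then show ?thesis by (simp add: volterra_def \<phi>_0)
  qed
  have "f 0 s - \<phi> s = 0"
  proof (rule volterra_unique[OF w_cont _ s w_le[of _ 0 0]])
    show "f 0 t - \<phi> t = volterra (w 0) (\<lambda>t. f 0 t - \<phi> t) t" if t: "0 \<le> t" for t
      using volterra_solution_eq[OF w_cont w_le[of _ 0 0] t] \<phi>_eq[OF t]
      by (simp add: volterra_diff[OF w_cont f_cont \<phi>_cont t] flip: f_def)
  qed (auto intro!: continuous_intros f_cont \<phi>_cont)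
  then show ?thesis by simp
qed

text \<open>Backward uniqueness from \<open>s0\<close>. With F = f and H = s f', the energy F^2 +
  H^2 has derivative 2 F H (1/s + w), which is at least -(1/a + M) times the energy on [a, s0]. The
  rate blows up as a tends to 0, so Gronwall is run for each fixed a > 0; f then vanishes on (0,
  s0], against continuity at 0 and f(0) = 1.\<close>

lemma f_zero_only_if:
  assumes s0: "0 \<le> s0" and f0: "f l s0 = 0" and p0: "p l s0 = 0"
  shows False
proof -
  have "s0 \<noteq> 0" using f0 f_0[of l] by auto
  with s0 have s0': "0 < s0" by simp
  define M where "M = \<bar>l\<bar> + B"
  have fa: "f l a = 0" if a: "0 < a" "a \<le> s0" for a
  proof -
    define c where "c = 1 / a + M"
    \<comment> \<open>Gronwall for the energy \<open>E\<close>, which vanishes at \<open>s0\<close>.\<close>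
    define E where "E s = (f l s)\<^sup>2 + (s * p l s)\<^sup>2" for s
    have "E a * exp (c * a) \<le> E s0 * exp (c * s0)"
    proof (rule deriv_nonneg_imp_mono[of a s0])
      fix s assume "s \<in> {a..s0}"
      with a have s: "0 < s" "a \<le> s" by auto
      define F where "F = f l s"
      define H where "H = s * p l s"
      have p: "p l s = H / s" using s by (simp add: H_def)
      have "(E has_real_derivative 2 * F * p l s + 2 * H * (w l s * F)) (at s)"
        unfolding E_def[abs_def] F_def H_def
        by (rule derivative_eq_intros
              f_deriv[of s l, unfolded at_within_atLeast[OF s(1)]]
              sp_deriv[of s l, unfolded at_within_atLeast[OF s(1)]] | use s in simp)+
      then show "((\<lambda>s. E s * exp (c * s)) has_real_derivative
          (2 * F * p l s + 2 * H * (w l s * F) + c * E s) * exp (c * s)) (at s)"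
        by (auto intro!: derivative_eq_intros simp: algebra_simps)
      have "\<bar>1 / s + w l s\<bar> \<le> c"
      proof -
        have "1 / s \<le> 1 / a" using s a by (simp add: frac_le)
        moreover have "\<bar>w l s\<bar> \<le> M" unfolding M_def by (rule w_le) (use s in auto)
        moreover have "0 < 1 / s" using s by simp
        ultimately show ?thesis unfolding c_def by linarith
      qed
      moreover have "\<bar>2 * F * H\<bar> \<le> E s"
      proof -
        have "0 \<le> (F - H)\<^sup>2" "0 \<le> (F + H)\<^sup>2" by auto
        then show ?thesis unfolding E_def F_def[symmetric] H_def[symmetric]
          by (simp add: power2_eq_square algebra_simps abs_le_iff)
      qed
      ultimately have "\<bar>1 / s + w l s\<bar> * \<bar>2 * F * H\<bar> \<le> c * E s"
        by (intro mult_mono) auto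
      then have "\<bar>(1 / s + w l s) * (2 * F * H)\<bar> \<le> c * E s" by (simp only: abs_mult)
      moreover have "(1 / s + w l s) * (2 * F * H) = 2 * F * p l s + 2 * H * (w l s * F)"
        by (simp add: p algebra_simps)
      ultimately show "0 \<le> (2 * F * p l s + 2 * H * (w l s * F) + c * E s) * exp (c * s)"
        by (intro mult_nonneg_nonneg) auto
    qed (use a in auto)
    also have "\<dots> = 0" by (simp add: E_def f0 p0)
    finally have "E a \<le> 0" by (simp add: mult_le_0_iff)
    then have "(f l a)\<^sup>2 \<le> 0" unfolding E_def by (smt (verit) zero_le_power2)
    then show ?thesis by simp
  qed
  from f_cont[of l, unfolded continuous_on_iff, rule_format, of 0 1]
  obtain d where d: "0 < d" "\<And>s. 0 \<le> s \<Longrightarrow> s < d \<Longrightarrow> \<bar>f l s - 1\<bar> < 1"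
    by (auto simp: f_0 dist_real_def)
  have "min s0 (d / 2) < d" "0 < min s0 (d / 2)" using d(1) s0' by auto
  with d(2)[of "min s0 (d / 2)"] fa[of "min s0 (d / 2)"] show False by auto
qed

text \<open>The product s f f' cannot fall below its positive value at \<open>s1\<close>, so f has
  no zero beyond \<open>s1\<close> and keeps its sign by the intermediate value theorem.\<close>

lemma f_pos_beyond:
  assumes s1: "0 < s1" "s1 \<le> s" and w: "\<And>s. s1 \<le> s \<Longrightarrow> 0 \<le> w l s"
    and f1: "0 < f l s1" and p1: "0 < p l s1"
  shows "0 < f l s"
proof -
  have y: "0 < r * f l r * p l r" if r: "s1 \<le> r" for r
  proof -
    \<comment> \<open>\<open>(s f f')' = s f'\<^sup>2 + w f\<^sup>2 \<ge> 0\<close> whatever the sign of \<open>f\<close>.\<close>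
    have "f l s1 * (s1 * p l s1) \<le> f l r * (r * p l r)"
    proof (rule deriv_nonneg_imp_mono[of s1 r])
      fix t assume "t \<in> {s1..r}"
      with s1 have t: "0 < t" "s1 \<le> t" by auto
      show "((\<lambda>t. f l t * (t * p l t)) has_real_derivative
          p l t * (t * p l t) + (w l t * f l t) * f l t) (at t)"
        by (rule DERIV_mult
              f_deriv[of t l, unfolded at_within_atLeast[OF t(1)]]
              sp_deriv[of t l, unfolded at_within_atLeast[OF t(1)]] | use t in simp)+
      have "0 \<le> t * (p l t)\<^sup>2 + w l t * (f l t)\<^sup>2"
        by (intro add_nonneg_nonneg mult_nonneg_nonneg w) (use t in auto)
      then show "0 \<le> p l t * (t * p l t) + (w l t * f l t) * f l t"
        by (simp add: power2_eq_square mult_ac)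
    qed (use r in auto)
    moreover have "0 < f l s1 * (s1 * p l s1)" using f1 p1 s1 by simp
    ultimately show ?thesis by (simp add: mult_ac)
  qed
  have ne: "f l r \<noteq> 0" if "s1 \<le> r" for r using y[OF that] by auto
  show ?thesis
  proof (rule ccontr)
    assume "\<not> 0 < f l s"
    moreover have "continuous_on {s1..s} (f l)"
      by (rule continuous_on_subset[OF f_cont]) (use s1 in auto)
    ultimately obtain r where "s1 \<le> r" "f l r = 0"
      using IVT2'[of "f l" s 0 s1] f1 s1 by auto
    with ne show False by blast
  qed
qed

lemma critical_energy:
  obtains l c S where "0 < l" "0 < c" "1 \<le> S"
    "\<And>s. 0 \<le> s \<Longrightarrow> 0 < f l s" "\<And>s. S \<le> s \<Longrightarrow> c \<le> w l s" "\<And>s. S \<le> s \<Longrightarrow> p l s \<le> 0"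
proof -
  \<comment> \<open>\<open>f l\<close> changes sign for \<open>l \<in> K\<close>; at the critical value \<open>m = Sup K\<close> its zero has escaped to infinity.\<close>
  define K where "K = {l. 0 \<le> l \<and> (\<exists>s\<ge>0. f l s < 0)}"
  \<comment> \<open>\<open>L\<close> lies strictly above every element of \<open>K\<close>, so each
    of them has room to its right within [0, L], where continuity in the energy is
    available.\<close>
  define L where "L = B + 1"
  have B0: "0 \<le> B" using v_nonneg[of 0] v_le[of 0] by simp
  have KB: "l < B" if "l \<in> K" for l
    using that f_nonneg_large[of l] unfolding K_def by force
  have 0: "0 \<in> K" using \<phi>_neg f_zero_energy by (auto simp: K_def)
  have bdd: "bdd_above K" using KB by (meson bdd_above.I less_imp_le)
  \<comment> \<open>Negativity at a fixed s persists for slightly larger l. Hence the supremum of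
    \<open>K\<close> is not attained.\<close>
  have opn: "\<exists>d>0. \<forall>l'. l \<le> l' \<and> l' < l + d \<longrightarrow> l' \<in> K" if l: "l \<in> K" for l
  proof -
    from l obtain s where s: "0 \<le> s" "f l s < 0" "0 \<le> l" by (auto simp: K_def)
    from KB[OF l] have lL: "l < L" by (simp add: L_def)
    from f_param_cont[OF s(1), of L, unfolded continuous_on_iff, rule_format, of l "- f l s"]
    obtain d where d: "0 < d" "\<And>l'. 0 \<le> l' \<Longrightarrow> l' \<le> L \<Longrightarrow> \<bar>l' - l\<bar> < d \<Longrightarrow> \<bar>f l' s - f l s\<bar> < - f l s"
      using s lL by (auto simp: dist_real_def)
    show ?thesis
    proof (intro exI[of _ "min d (L - l)"] conjI allI impI)
      fix l' assume l': "l \<le> l' \<and> l' < l + min d (L - l)"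
      then have "\<bar>f l' s - f l s\<bar> < - f l s" using s by (intro d(2)) auto
      then have "f l' s < 0" by linarith
      with s l' show "l' \<in> K" by (auto simp: K_def)
    qed (use d lL in auto)
  qed
  define m where "m = Sup K"
  have up: "l \<le> m" if "l \<in> K" for l unfolding m_def by (rule cSup_upper[OF that bdd])
  have m: "m \<notin> K"
  proof
    assume "m \<in> K"
    from opn[OF this] obtain d where "0 < d" "\<And>l'. m \<le> l' \<Longrightarrow> l' < m + d \<Longrightarrow> l' \<in> K" by auto
    from up[OF this(2)[of "m + d / 2"]] this(1) show False by auto
  qed
  have m0: "0 < m" using up[OF 0] m 0 by (cases "m = 0") auto
  have mL: "m < L"
  proof -
    have "m \<le> B"
      unfolding m_def by (rule cSup_least) (use 0 KB in \<open>auto intro: less_imp_le\<close>)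
    then show ?thesis by (simp add: L_def)
  qed
  have f_nn: "0 \<le> f m s" if "0 \<le> s" for s
    using m m0 that by (auto simp: K_def not_less)
  \<comment> \<open>A zero of the nonnegative function \<open>f m\<close> would be a minimum,
    interior because f(0) = 1, so the slope would vanish there as well.\<close>
  have f_pos: "0 < f m s" if s: "0 \<le> s" for s
  proof (rule ccontr)
    assume "\<not> 0 < f m s"
    with f_nn[OF s] have z: "f m s = 0" by simp
    then have s': "0 < s" using s f_0[of m] by (cases "s = 0") auto
    have "p m s = 0"
    proof (rule DERIV_local_min[of "f m" _ s s])
      show "(f m has_real_derivative p m s) (at s)"
        using f_deriv[OF s, of m] at_within_atLeast[OF s'] by simp
      show "\<forall>y. \<bar>s - y\<bar> < s \<longrightarrow> f m s \<le> f m y" using f_nn z by auto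
    qed (use s' in auto)
    from f_zero_only_if[OF s z this] show False .
  qed
  from v_lim have "\<forall>\<^sub>F s in at_top. v s < m / 4"
    by (rule order_tendstoD) (use m0 in simp)
  then obtain S0 where S0: "\<And>s. S0 \<le> s \<Longrightarrow> v s < m / 4" by (auto simp: eventually_at_top_linorder)
  define S where "S = max S0 1"
  \<comment> \<open>The slack between m/2 and m makes one threshold \<open>S\<close> serve all
    energies just below m, not only m itself.\<close>
  have w: "m / 4 \<le> w l s" if "m / 2 \<le> l" "S \<le> s" for l s
    using S0[of s] that by (simp add: w_def S_def)
  \<comment> \<open>Otherwise, for \<open>l\<close> close to \<open>m\<close>, \<open>f l\<close> would be positive on \<open>[0, s1]\<close> and increasing beyond, so \<open>l \<notin> K\<close>.\<close>
  have p: "p m s1 \<le> 0" if s1: "S \<le> s1" for s1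
  proof (rule ccontr)
    assume "\<not> p m s1 \<le> 0"
    then have p1: "0 < p m s1" by simp
    from s1 have s1': "0 < s1" "0 \<le> s1" by (auto simp: S_def)
    have "continuous_on {0..s1} (f m)" by (rule continuous_on_subset[OF f_cont]) auto
    from continuous_attains_inf[OF _ _ this] s1'
    obtain r where r: "r \<in> {0..s1}" "\<And>s. s \<in> {0..s1} \<Longrightarrow> f m r \<le> f m s" by auto
    have fr: "0 < f m r" using f_pos r by auto
    \<comment> \<open>With the positive minimum of \<open>f m\<close> on [0, s1] as tolerance,
      \<open>f l\<close> stays positive on that whole interval for all l close to m.\<close>
    have "uniformly_continuous_on ({0..L} \<times> {0..s1}) (\<lambda>(l, s). f l s)"
      by (intro compact_uniformly_continuous continuous_on_subset[OF f_joint_cont] compact_Times) auto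
    from this[unfolded uniformly_continuous_on_def, rule_format, OF fr]
    obtain d1 where d1: "0 < d1" and d1': "\<And>x y. x \<in> {0..L} \<times> {0..s1} \<Longrightarrow> y \<in> {0..L} \<times> {0..s1} \<Longrightarrow>
        dist y x < d1 \<Longrightarrow> dist (case y of (l, s) \<Rightarrow> f l s) (case x of (l, s) \<Rightarrow> f l s) < f m r"
      by auto
    have fl: "0 < f l s" if "0 \<le> l" "l \<le> L" "\<bar>l - m\<bar> < d1" "0 \<le> s" "s \<le> s1" for l s
    proof -
      have "\<bar>f l s - f m s\<bar> < f m r"
        using d1'[of "(m, s)" "(l, s)"] that m0 mL by (auto simp: dist_Pair_Pair dist_real_def)
      with r(2)[of s] that show ?thesis by auto
    qed
    from p_param_cont[OF s1'(2), of L, unfolded continuous_on_iff, rule_format, of m "p m s1"]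
    obtain d2 where d2: "0 < d2" "\<And>l. 0 \<le> l \<Longrightarrow> l \<le> L \<Longrightarrow> \<bar>l - m\<bar> < d2 \<Longrightarrow> \<bar>p l s1 - p m s1\<bar> < p m s1"
      using p1 m0 mL by (auto simp: dist_real_def)
    have "m - min (m / 2) (min d1 d2) < m" using m0 d1 d2 by auto
    then obtain l where l: "l \<in> K" "m - min (m / 2) (min d1 d2) < l"
      using less_cSup_iff[OF _ bdd] 0 unfolding m_def by blast
    have lm: "l \<le> m" "m / 2 \<le> l" "\<bar>l - m\<bar> < d1" "\<bar>l - m\<bar> < d2" "0 \<le> l" "l \<le> L"
      using up[OF l(1)] l(2) mL m0 by auto
    have pl: "0 < p l s1" using d2(2)[of l] lm by auto
    have "0 \<le> f l s" if s: "0 \<le> s" for s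
    proof (cases "s \<le> s1")
      case True
      then show ?thesis using fl[of l s] lm s by auto
    next
      case False
      have "0 < f l s"
      proof (rule f_pos_beyond[OF s1'(1) _ _ _ pl])
        show "0 \<le> w l t" if "s1 \<le> t" for t
          using w[of l t] lm that s1 m0 by auto
      qed (use False fl[of l s1] lm s1' in auto)
      then show ?thesis by simp
    qed
    with l(1) show False by (auto simp: K_def not_less[symmetric])
  qed
  show thesis
    by (rule that[of m "m / 4" S]) (use m0 f_pos w p in \<open>auto simp: S_def\<close>)
qed

end

section \<open>Decay of the critical solution\<close>

text \<open>Compactness covers [0, T], at the price of (1 + T)^2; beyond T, where s \<ge> 1, the
  factor 4 comes from 1 + s \<le> 2 s.\<close>

lemma bounded_by_inverse_square:
  fixes g :: "real \<Rightarrow> real"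
  assumes g: "continuous_on {0..} g" and T: "1 \<le> T" and D: "\<And>s. T \<le> s \<Longrightarrow> \<bar>g s\<bar> \<le> D / s\<^sup>2"
  shows "\<exists>C. \<forall>s\<ge>0. \<bar>g s\<bar> \<le> C / (1 + s)\<^sup>2"
proof -
  have "compact (g ` {0..T})"
    by (intro compact_continuous_image continuous_on_subset[OF g]) auto
  then obtain M where M: "\<And>s. s \<in> {0..T} \<Longrightarrow> \<bar>g s\<bar> \<le> M"
    using compact_imp_bounded[of "g ` {0..T}"] by (force simp: bounded_iff)
  have M0: "0 \<le> M" using M[of 0] T by fastforce
  have D0: "0 \<le> D"
  proof (rule ccontr)
    assume "\<not> 0 \<le> D"
    then have "D / T\<^sup>2 < 0" using T by (simp add: divide_neg_pos)
    with D[of T] show False by linarith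
  qed
  show ?thesis
  proof (intro exI[of _ "M * (1 + T)\<^sup>2 + 4 * D"] allI impI)
    fix s :: real assume s: "0 \<le> s"
    show "\<bar>g s\<bar> \<le> (M * (1 + T)\<^sup>2 + 4 * D) / (1 + s)\<^sup>2"
    proof (cases "s \<le> T")
      case True
      have "\<bar>g s\<bar> * (1 + s)\<^sup>2 \<le> M * (1 + T)\<^sup>2"
        by (intro mult_mono power_mono M) (use True s M0 in auto)
      then show ?thesis using s D0 by (simp add: pos_le_divide_eq)
    next
      case False
      then have s1: "1 \<le> s" using T by simp
      have "(1 + s)\<^sup>2 \<le> (2 * s)\<^sup>2" by (rule power_mono) (use s1 in auto)
      then have "\<bar>g s\<bar> * (1 + s)\<^sup>2 \<le> D / s\<^sup>2 * (2 * s)\<^sup>2"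
        by (intro mult_mono D) (use False D0 in auto)
      also have "\<dots> = 4 * D" using s1 by (simp add: power_mult_distrib)
      also have "\<dots> \<le> M * (1 + T)\<^sup>2 + 4 * D" using M0 by simp
      finally show ?thesis using s by (simp add: pos_le_divide_eq)
    qed
  qed
qed

context attractive_well begin

text \<open>Beyond \<open>S\<close>, f is nonincreasing and s f' nondecreasing, so intermediate
  values in the mean value theorem on [s, 2 s] can be traded for endpoint values. The exponent 2 is
  what the plane requires: second derivatives of f(|z|^2) carry a factor |z|^2, which leaves
  O(|z|^-2), still square integrable.\<close>

lemma decay:
  assumes c: "0 < c" and S: "1 \<le> S" and fpos: "\<And>s. 0 \<le> s \<Longrightarrow> 0 < f l s"
    and w: "\<And>s. S \<le> s \<Longrightarrow> c \<le> w l s" and p: "\<And>s. S \<le> s \<Longrightarrow> p l s \<le> 0"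
  shows "\<exists>D T. S \<le> T \<and> (\<forall>s\<ge>T. \<bar>f l s\<bar> \<le> D / s\<^sup>2 \<and> \<bar>p l s\<bar> \<le> D / s\<^sup>2)"
proof -
  have anti: "f l b \<le> f l a" if "S \<le> a" "a \<le> b" for a b
  proof (rule DERIV_nonpos_imp_nonincreasing[OF that(2)])
    fix x assume "a \<le> x" "x \<le> b"
    with that S have "0 < x" "S \<le> x" by auto
    then show "\<exists>y. DERIV (f l) x :> y \<and> y \<le> 0"
      using f_deriv[of x l] p[of x] at_within_atLeast[of x] by auto
  qed
  have mono: "a * p l a \<le> b * p l b" if "S \<le> a" "a \<le> b" for a b
  proof (rule DERIV_nonneg_imp_nondecreasing[OF that(2)])
    fix x assume "a \<le> x" "x \<le> b"
    with that S have x: "0 < x" "S \<le> x" by auto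
    then have "0 \<le> w l x * f l x" using w[of x] c fpos[of x] by auto
    then show "\<exists>y. DERIV (\<lambda>x. x * p l x) x :> y \<and> 0 \<le> y"
      using sp_deriv[of x l] at_within_atLeast[of x] x by auto
  qed
  \<comment> \<open>The next two bounds combine to \<open>f (4 s) \<le> f s / (c s)\<close>, each use of which gains a factor \<open>1 / s\<close>.\<close>
  have 1: "c * s * f l (2 * s) \<le> - (s * p l s)" if s: "S \<le> s" for s
  proof -
    have "\<exists>z>s. z < 2 * s \<and> 2 * s * p l (2 * s) - s * p l s = (2 * s - s) * (w l z * f l z)"
    proof (rule MVT2)
      fix x assume "s \<le> x" "x \<le> 2 * s"
      with s S have "0 < x" by auto
      then show "DERIV (\<lambda>x. x * p l x) x :> w l x * f l x"
        using sp_deriv[of x l] at_within_atLeast[of x] by auto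
    qed (use s S in auto)
    then obtain z where z: "s < z" "z < 2 * s"
      "2 * s * p l (2 * s) - s * p l s = s * (w l z * f l z)" by auto
    have "c * f l (2 * s) \<le> w l z * f l z"
      by (intro mult_mono w anti) (use z s S c fpos[of "2 * s"] in \<open>auto intro: order_trans[OF less_imp_le w]\<close>)
    then have "s * (c * f l (2 * s)) \<le> s * (w l z * f l z)"
      by (rule mult_left_mono) (use s S in auto)
    moreover have "2 * s * p l (2 * s) \<le> 0"
      using p[of "2 * s"] s S by (auto simp: mult_le_0_iff)
    ultimately show ?thesis using z(3) by (simp add: mult_ac)
  qed
  have 2: "- (s * p l (2 * s)) \<le> f l s" if s: "S \<le> s" for s
  proof -
    have "\<exists>z>s. z < 2 * s \<and> f l (2 * s) - f l s = (2 * s - s) * p l z"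
    proof (rule MVT2)
      fix x assume "s \<le> x" "x \<le> 2 * s"
      with s S have "0 < x" by auto
      then show "DERIV (f l) x :> p l x"
        using f_deriv[of x l] at_within_atLeast[of x] by auto
    qed (use s S in auto)
    then obtain z where z: "s < z" "z < 2 * s" "f l (2 * s) - f l s = s * p l z" by auto
    have "z * p l z \<le> 2 * s * p l (2 * s)" by (rule mono) (use z s in auto)
    moreover have "2 * s * p l z \<le> z * p l z"
      using z p[of z] s by (intro mult_right_mono_neg) auto
    ultimately have "s * p l z \<le> s * p l (2 * s)" by simp
    moreover have "0 < f l (2 * s)" using s S by (intro fpos) simp
    ultimately show ?thesis using z(3) by linarith
  qed
  have 3: "f l (4 * s) \<le> f l s / (c * s)" if s: "S \<le> s" for s
  proof -
    have "c * (2 * s) * f l (2 * (2 * s)) \<le> - (2 * s * p l (2 * s))"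
      by (rule 1) (use s S in auto)
    also have "\<dots> \<le> 2 * f l s" using 2[OF s] by simp
    finally have "f l (4 * s) * (c * s) \<le> f l s" by (simp add: mult_ac)
    then show ?thesis using c s S by (simp add: pos_le_divide_eq)
  qed
  have 4: "f l s \<le> 4 * f l S / c / s" if s: "4 * S \<le> s" for s
  proof -
    have "f l s \<le> f l (s / 4) / (c * (s / 4))" using 3[of "s / 4"] s by simp
    also have "\<dots> \<le> f l S / (c * (s / 4))"
      by (intro divide_right_mono anti) (use s S c in auto)
    finally show ?thesis using s S c by (simp add: field_simps)
  qed
  \<comment> \<open>The constant results from bound \<open>4\<close> at s/4, which gives 16 f(S) /
    (c s), followed by one more division by c s/4.\<close>
  define D where "D = 64 * f l S / c\<^sup>2"
  have 5: "f l s \<le> D / s\<^sup>2" if s: "16 * S \<le> s" for s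
  proof -
    have "f l s \<le> f l (s / 4) / (c * (s / 4))" using 3[of "s / 4"] s S by simp
    also have "\<dots> \<le> (4 * f l S / c / (s / 4)) / (c * (s / 4))"
      by (intro divide_right_mono 4) (use s S c in auto)
    also have "\<dots> = D / s\<^sup>2" using s S c by (simp add: D_def field_simps power2_eq_square)
    finally show ?thesis .
  qed
  have D0: "0 < D" using fpos[of S] S c by (simp add: D_def)
  \<comment> \<open>Bound \<open>2\<close> at s/2 gives s |f'(s)| / 2 \<le> D / (s/2)^2, hence the
    8; the spare factor 1/s is dropped. The threshold ensures that s/2 is in the range of bound
    \<open>5\<close>.\<close>
  have 6: "\<bar>p l s\<bar> \<le> 8 * D / s\<^sup>2" if s: "32 * S \<le> s" for s
  proof -
    have "- (s / 2 * p l (2 * (s / 2))) \<le> D / (s / 2)\<^sup>2"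
      using 2[of "s / 2"] 5[of "s / 2"] s S by auto
    then have "- (s * p l s) \<le> 8 * D / s\<^sup>2" by (simp add: field_simps)
    moreover have "- p l s \<le> - (s * p l s)"
      using s S p[of s] mult_right_mono_neg[of 1 s "p l s"] by auto
    ultimately show ?thesis using p[of s] s S by auto
  qed
  show ?thesis
  proof (rule exI[of _ "8 * D"], rule exI[of _ "32 * S"], intro conjI allI impI)
    fix s assume s: "32 * S \<le> s"
    have "f l s \<le> D / s\<^sup>2" using 5[of s] s S by simp
    also have "\<dots> \<le> 8 * D / s\<^sup>2" using D0 by (intro divide_right_mono) auto
    finally show "\<bar>f l s\<bar> \<le> 8 * D / s\<^sup>2" using fpos[of s] s S by simp
    show "\<bar>p l s\<bar> \<le> 8 * D / s\<^sup>2" by (rule 6[OF s])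
  qed (use S in auto)
qed

text \<open>Decay of the second derivative q is read off the equation: s q = w f - f' inherits the
  decay of f and f', and |q| \<le> |s q| for s \<ge> 1.\<close>

lemma bound_state:
  obtains l g g' g'' C where "0 < l" "g 0 = 1" "continuous_on {0..} g''"
    "\<And>s. 0 \<le> s \<Longrightarrow> (g has_real_derivative g' s) (at s within {0..})"
    "\<And>s. 0 \<le> s \<Longrightarrow> (g' has_real_derivative g'' s) (at s within {0..})"
    "\<And>s. 0 \<le> s \<Longrightarrow> g' s + s * g'' s = (l - v s) * g s"
    "\<And>s. 0 \<le> s \<Longrightarrow> \<bar>g s\<bar> \<le> C / (1 + s)\<^sup>2"
    "\<And>s. 0 \<le> s \<Longrightarrow> \<bar>g' s\<bar> \<le> C / (1 + s)\<^sup>2"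
    "\<And>s. 0 \<le> s \<Longrightarrow> \<bar>g'' s\<bar> \<le> C / (1 + s)\<^sup>2"
proof -
  obtain l c S where l: "0 < l" "0 < c" "1 \<le> S"
    "\<And>s. 0 \<le> s \<Longrightarrow> 0 < f l s" "\<And>s. S \<le> s \<Longrightarrow> c \<le> w l s" "\<And>s. S \<le> s \<Longrightarrow> p l s \<le> 0"
    by (rule critical_energy) (rule that; blast)
  have "\<exists>D T. S \<le> T \<and> (\<forall>s\<ge>T. \<bar>f l s\<bar> \<le> D / s\<^sup>2 \<and> \<bar>p l s\<bar> \<le> D / s\<^sup>2)"
    by (rule decay[of c S l]) (use l in auto)
  then obtain D T where T: "S \<le> T" and fD: "\<And>s. T \<le> s \<Longrightarrow> \<bar>f l s\<bar> \<le> D / s\<^sup>2"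
    and pD: "\<And>s. T \<le> s \<Longrightarrow> \<bar>p l s\<bar> \<le> D / s\<^sup>2"
    by auto
  have wf: "((\<lambda>t. w l t * f l t) has_real_derivative - v' s * f l s + p l s * w l s) (at s within {0..})"
    if "0 \<le> s" for s
    using DERIV_mult[OF DERIV_diff[OF DERIV_const v_deriv] f_deriv, OF that that, of l l]
    by (simp add: w_def)
  have "continuous_on {0..} (\<lambda>s. - v' s * f l s + p l s * w l s)"
    by (intro continuous_intros v'_cont f_cont p_cont w_cont)
  with wf have "\<exists>q. continuous_on {0..} q \<and>
      (\<forall>s\<ge>0. (p l has_real_derivative q s) (at s within {0..}) \<and> p l s + s * q s = w l s * f l s)"
    unfolding p_def by (rule avg_has_derivative)
  then obtain q where q: "continuous_on {0..} q"
    "\<And>s. 0 \<le> s \<Longrightarrow> (p l has_real_derivative q s) (at s within {0..})"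
    "\<And>s. 0 \<le> s \<Longrightarrow> p l s + s * q s = w l s * f l s"
    by auto
  have D0: "0 \<le> D / T\<^sup>2" using fD[of T] by linarith
  have T1: "1 \<le> T" using T l by simp
  with D0 have D0: "0 \<le> D" by (simp add: zero_le_divide_iff)
  have B0: "0 \<le> B" using v_nonneg[of 0] v_le[of 0] by simp
  have qD: "\<bar>q s\<bar> \<le> ((l + B) * D + D) / s\<^sup>2" if s: "T \<le> s" for s
  proof -
    have s1: "1 \<le> s" using s T1 by simp
    have "\<bar>w l s * f l s\<bar> \<le> (l + B) * (D / s\<^sup>2)"
      unfolding abs_mult by (intro mult_mono fD s w_le) (use s1 l B0 in auto)
    then have "\<bar>w l s * f l s - p l s\<bar> \<le> (l + B) * (D / s\<^sup>2) + D / s\<^sup>2"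
      using pD[OF s] by linarith
    also have "\<dots> = ((l + B) * D + D) / s\<^sup>2" by (simp add: add_divide_distrib)
    finally have "\<bar>s * q s\<bar> \<le> ((l + B) * D + D) / s\<^sup>2" using q(3)[of s] s1 by (simp add: algebra_simps)
    moreover have "\<bar>q s\<bar> \<le> \<bar>s * q s\<bar>" using s1 mult_right_mono[of 1 s "\<bar>q s\<bar>"] by (simp add: abs_mult)
    ultimately show ?thesis by linarith
  qed
  obtain C1 where C1: "\<And>s. 0 \<le> s \<Longrightarrow> \<bar>f l s\<bar> \<le> C1 / (1 + s)\<^sup>2"
    using bounded_by_inverse_square[OF f_cont T1 fD] by blast
  obtain C2 where C2: "\<And>s. 0 \<le> s \<Longrightarrow> \<bar>p l s\<bar> \<le> C2 / (1 + s)\<^sup>2"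
    using bounded_by_inverse_square[OF p_cont T1 pD] by blast
  obtain C3 where C3: "\<And>s. 0 \<le> s \<Longrightarrow> \<bar>q s\<bar> \<le> C3 / (1 + s)\<^sup>2"
    using bounded_by_inverse_square[OF q(1) T1 qD] by blast
  define C where "C = max C1 (max C2 C3)"
  have le: "x \<le> C / (1 + s)\<^sup>2" if "x \<le> C' / (1 + s)\<^sup>2" "C' \<le> C" for x s C' :: real
    using that by (meson divide_right_mono order_trans zero_le_power2)
  show thesis
  proof (rule that[of l "f l" q "p l" C])
    show "p l s + s * q s = (l - v s) * f l s" if "0 \<le> s" for s
      using q(3)[OF that] by (simp add: w_def)
  qed (use l q f_0 f_deriv le[OF C1] le[OF C2] le[OF C3] in \<open>auto simp: C_def\<close>)
qed

end

section \<open>The concrete well\<close>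

text \<open>In the variable s = |z|^2 this is minus one quarter of the potential, matching \<Delta>
  = 4 d/ds (s d/ds) on radial functions.\<close>

definition pot :: "nat \<Rightarrow> real \<Rightarrow> real" where
  "pot n s = 2 * (real n)\<^sup>2 * s ^ (n - 1) / (1 + s ^ n)\<^sup>2"

lemma power_deriv_Suc:
  "((\<lambda>s::real. s ^ Suc m) has_real_derivative real (Suc m) * s ^ m) (at s within A)"
  using DERIV_pow[of "Suc m" s A] by simp

lemma zero_energy_solution_deriv:
  fixes s :: real
  assumes s: "0 \<le> s" shows "((\<lambda>s. (1 - s ^ Suc m) / (1 + s ^ Suc m)) has_real_derivative - 2 * real (Suc m) * s ^ m / (1 + s ^ Suc m)\<^sup>2)
         (at s within {0..})"
proof -
  define a where "a = s ^ Suc m"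
  have "0 < 1 + a" using zero_le_power[OF s, of "Suc m"] by (simp add: a_def)
  then show ?thesis
    apply -
    apply (rule derivative_eq_intros power_deriv_Suc refl | simp add: a_def[symmetric] del: power_Suc)+
    apply (simp add: field_simps power2_eq_square a_def)
    done
qed

lemma zero_energy_solution_deriv2:
  fixes s :: real
  assumes s: "0 \<le> s" shows "((\<lambda>s. s * (- 2 * real (Suc m) * s ^ m / (1 + s ^ Suc m)\<^sup>2)) has_real_derivative
          - (2 * (real (Suc m))\<^sup>2 * s ^ m / (1 + s ^ Suc m)\<^sup>2) * ((1 - s ^ Suc m) / (1 + s ^ Suc m))) (at s within {0..})"
proof -
  define a where "a = s ^ Suc m"
  have a: "0 < 1 + a" using zero_le_power[OF s, of "Suc m"] by (simp add: a_def)
  have "((\<lambda>s. - 2 * real (Suc m) * (s ^ Suc m / (1 + s ^ Suc m)\<^sup>2)) has_real_derivative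
      - 2 * real (Suc m) * ((real (Suc m) * s ^ m * (1 + a)\<^sup>2 - a * (2 * (1 + a) * (real (Suc m) * s ^ m))) / ((1 + a)\<^sup>2 * (1 + a)\<^sup>2))) (at s within {0..})"
    using a
    by - (rule derivative_eq_intros power_deriv_Suc refl | simp add: a_def[symmetric] del: power_Suc of_nat_Suc)+
  also have "- 2 * real (Suc m) * ((real (Suc m) * s ^ m * (1 + a)\<^sup>2 - a * (2 * (1 + a) * (real (Suc m) * s ^ m))) / ((1 + a)\<^sup>2 * (1 + a)\<^sup>2)) =
     - (2 * (real (Suc m))\<^sup>2 * s ^ m / (1 + a)\<^sup>2) * ((1 - a) / (1 + a))"
    using a by (simp add: divide_simps power2_eq_square del: of_nat_Suc) (simp add: algebra_simps)
  finally show ?thesis by (simp add: a_def mult_ac)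
qed

lemma pot_deriv:
  fixes s :: real
  assumes s: "0 \<le> s" shows "((\<lambda>s. 2 * (real (Suc (Suc m)))\<^sup>2 * s ^ Suc m / (1 + s ^ Suc (Suc m))\<^sup>2) has_real_derivative
         2 * (real (Suc (Suc m)))\<^sup>2 * (real (Suc m) * s ^ m * (1 + s ^ Suc (Suc m)) - 2 * real (Suc (Suc m)) * (s ^ Suc m)\<^sup>2) / (1 + s ^ Suc (Suc m)) ^ 3)
         (at s within {0..})"
proof -
  define a where "a = s ^ Suc (Suc m)"
  define b where "b = s ^ Suc m"
  define N where "N = real (Suc (Suc m))"
  have a: "0 < 1 + a" using zero_le_power[OF s, of "Suc (Suc m)"] by (simp only: a_def)
  have "((\<lambda>s. 2 * N\<^sup>2 * (s ^ Suc m / (1 + s ^ Suc (Suc m))\<^sup>2)) has_real_derivative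
      2 * N\<^sup>2 * ((real (Suc m) * s ^ m * (1 + a)\<^sup>2 - b * (2 * (1 + a) * (N * b))) / ((1 + a)\<^sup>2 * (1 + a)\<^sup>2))) (at s within {0..})"
    using a
    by - (rule derivative_eq_intros power_deriv_Suc refl | simp add: a_def[symmetric] b_def[symmetric] N_def[symmetric] del: power_Suc of_nat_Suc)+
  also have "2 * N\<^sup>2 * ((real (Suc m) * s ^ m * (1 + a)\<^sup>2 - b * (2 * (1 + a) * (N * b))) / ((1 + a)\<^sup>2 * (1 + a)\<^sup>2)) =
     2 * N\<^sup>2 * (real (Suc m) * s ^ m * (1 + a) - 2 * N * b\<^sup>2) / (1 + a) ^ 3"
    using a by (simp add: divide_simps power2_eq_square power3_eq_cube del: of_nat_Suc) (simp add: algebra_simps)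
  finally show ?thesis unfolding a_def b_def N_def by simp
qed

text \<open>Since s^(m+1) \<le> (1 + s^(m+1))^2, the quotient is at most a constant times
  1/s.\<close>

lemma pot_tendsto: "((\<lambda>s. 2 * (real (Suc m))\<^sup>2 * s ^ m / (1 + s ^ Suc m)\<^sup>2) \<longlongrightarrow> 0) at_top"
proof (rule tendsto_sandwich)
  show "\<forall>\<^sub>F s in at_top. 0 \<le> 2 * (real (Suc m))\<^sup>2 * s ^ m / (1 + s ^ Suc m)\<^sup>2"
    using eventually_ge_at_top[of 0] by eventually_elim auto
  show "\<forall>\<^sub>F s in at_top. 2 * (real (Suc m))\<^sup>2 * s ^ m / (1 + s ^ Suc m)\<^sup>2 \<le> 2 * (real (Suc m))\<^sup>2 * inverse s"
    using eventually_gt_at_top[of 0]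
  proof eventually_elim
    case (elim s)
    have "s ^ m * s \<le> (1 + s ^ Suc m)\<^sup>2"
    proof -
      have "s ^ m * s \<le> 1 + s ^ Suc m" by (simp add: mult.commute)
      also have "\<dots> \<le> (1 + s ^ Suc m)\<^sup>2" using elim by (intro self_le_power) auto
      finally show ?thesis .
    qed
    moreover have "0 < (1 + s ^ Suc m)\<^sup>2"
      using elim by (intro zero_less_power add_pos_pos) auto
    ultimately have "s ^ m / (1 + s ^ Suc m)\<^sup>2 \<le> inverse s"
      using elim by (simp only: inverse_eq_divide pos_divide_le_eq pos_le_divide_eq
          times_divide_eq_left mult_1)
    from mult_left_mono[OF this, of "2 * (real (Suc m))\<^sup>2"] show ?case by simp
  qed
  show "((\<lambda>s. 2 * (real (Suc m))\<^sup>2 * inverse s) \<longlongrightarrow> 0) at_top"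
    by (intro tendsto_mult_right_zero tendsto_inverse_0_at_top filterlim_ident)
qed simp

lemma attractive_well_pot:
  assumes n: "n \<ge> 2"
  shows "attractive_well (pot n)
     (\<lambda>s. 2 * (real n)\<^sup>2 * ((real n - 1) * s ^ (n - 2) * (1 + s ^ n) - 2 * real n * (s ^ (n - 1))\<^sup>2) / (1 + s ^ n) ^ 3)
     (\<lambda>s. (1 - s ^ n) / (1 + s ^ n)) (\<lambda>s. - 2 * real n * s ^ (n - 1) / (1 + s ^ n)\<^sup>2) (2 * (real n)\<^sup>2)"
proof
  \<comment> \<open>This removes the truncated subtractions n - 1 and n - 2, so that the derivative
    computations above apply.\<close>
  obtain m where m: "n = Suc (Suc m)" using n by (metis add_2_eq_Suc le_Suc_ex)
  have pos: "0 < 1 + s ^ n" if "0 \<le> s" for s :: real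
    using zero_le_power[OF that, of n] by linarith
  have m1: "real (Suc (Suc m)) - 1 = real (Suc m)" by simp
  {
    fix s :: real assume s: "0 \<le> s"
    show "(pot n has_real_derivative
         2 * (real n)\<^sup>2 * ((real n - 1) * s ^ (n - 2) * (1 + s ^ n) - 2 * real n * (s ^ (n - 1))\<^sup>2) / (1 + s ^ n) ^ 3)
         (at s within {0..})"
      using pot_deriv[OF s, of m] by (simp add: m m1 pot_def[abs_def] del: power_Suc of_nat_Suc)
    show "((\<lambda>s. (1 - s ^ n) / (1 + s ^ n)) has_real_derivative - 2 * real n * s ^ (n - 1) / (1 + s ^ n)\<^sup>2)
         (at s within {0..})"
      using zero_energy_solution_deriv[OF s, of "Suc m"] by (simp add: m pot_def[abs_def] del: power_Suc of_nat_Suc)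
    show "((\<lambda>s. s * (- 2 * real n * s ^ (n - 1) / (1 + s ^ n)\<^sup>2)) has_real_derivative
          - pot n s * ((1 - s ^ n) / (1 + s ^ n))) (at s within {0..})"
      using zero_energy_solution_deriv2[OF s, of "Suc m"] by (simp add: m pot_def[abs_def] del: power_Suc of_nat_Suc)
    show "0 \<le> pot n s" using s by (simp add: pot_def)
    have "s ^ (n - 1) \<le> (1 + s ^ n)\<^sup>2"
    proof -
      have "s ^ (n - 1) \<le> 1 + s ^ n"
      proof (cases "s \<le> 1")
        case True
        then show ?thesis using s power_le_one[of s "n - 1"] zero_le_power[of s n] by linarith
      next
        case False
        then have "s ^ (n - 1) \<le> s ^ n" by (intro power_increasing) auto
        then show ?thesis by simp
      qed
      also have "\<dots> \<le> (1 + s ^ n)\<^sup>2" using s by (intro self_le_power) auto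
      finally show ?thesis .
    qed
    then show "pot n s \<le> 2 * (real n)\<^sup>2"
      using pos[OF s] by (simp add: pot_def divide_le_eq mult_left_mono)
  }
  show "continuous_on {0..} (\<lambda>s. 2 * (real n)\<^sup>2 * ((real n - 1) * s ^ (n - 2) * (1 + s ^ n) - 2 * real n * (s ^ (n - 1))\<^sup>2) / (1 + s ^ n) ^ 3)"
    by (intro continuous_intros) (use pos in force)
  show "(pot n \<longlongrightarrow> 0) at_top"
    using pot_tendsto[of "Suc m"] by (simp add: m pot_def[abs_def] del: power_Suc of_nat_Suc)
  show "\<exists>s\<ge>0. (1 - s ^ n) / (1 + s ^ n) < (0::real)"
    \<comment> \<open>The numerator 1 - s^n is negative for every s > 1.\<close>
    by (rule exI[of _ 2]) (use n one_less_power[of "2::real" n] in \<open>auto intro!: divide_neg_pos add_pos_pos\<close>)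
qed (use n in \<open>auto simp: pot_def power_0_left\<close>)

section \<open>Integration by parts in the plane\<close>

text \<open>\<open>pderiv_dir\<close> returns an arbitrary value where no derivative exists. This
  relation also asserts existence, everywhere on the plane.\<close>

definition has_pderiv :: "complex \<Rightarrow> (complex \<Rightarrow> complex) \<Rightarrow> (complex \<Rightarrow> complex) \<Rightarrow> bool" where
  "has_pderiv v u g \<longleftrightarrow> (\<forall>z. ((\<lambda>t::real. u (z + t *\<^sub>R v)) has_vector_derivative g z) (at 0))"

lemma has_pderiv_eq: "has_pderiv v u g \<Longrightarrow> pderiv_dir v u = g"
  by (auto simp: has_pderiv_def pderiv_dir_def fun_eq_iff intro: vector_derivative_at)

lemma has_pderiv_mult:
  assumes "has_pderiv v u u'" "has_pderiv v f f'"
  shows "has_pderiv v (\<lambda>z. u z * f z) (\<lambda>z. u z * f' z + u' z * f z)"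
  unfolding has_pderiv_def
proof
  fix z
  from has_vector_derivative_mult[OF assms[unfolded has_pderiv_def, rule_format, of z]]
  show "((\<lambda>t. u (z + t *\<^sub>R v) * f (z + t *\<^sub>R v)) has_vector_derivative u z * f' z + u' z * f z) (at 0)"
    by simp
qed

lemma has_pderiv_id: "has_pderiv v (\<lambda>z. z) (\<lambda>z. v)"
  unfolding has_pderiv_def by (auto intro!: derivative_eq_intros)

lemma has_pderiv_inner: "has_pderiv v (\<lambda>z. of_real (z \<bullet> w)) (\<lambda>z. of_real (v \<bullet> w))"
  unfolding has_pderiv_def inner_add_left inner_scaleR_left
proof
  fix z
  have "((\<lambda>t. z \<bullet> w + t * (v \<bullet> w)) has_real_derivative v \<bullet> w) (at 0)"
    by (auto intro!: derivative_eq_intros)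
  then show "((\<lambda>t. of_real (z \<bullet> w + t * (v \<bullet> w))) has_vector_derivative of_real (v \<bullet> w)) (at 0)"
    by (rule has_vector_derivative_of_real)
qed

lemma has_pderiv_line:
  assumes "has_pderiv v u g"
  shows "((\<lambda>t. u (z + t *\<^sub>R v)) has_vector_derivative g (z + t *\<^sub>R v)) (at t)"
proof -
  have "((\<lambda>r. u ((z + t *\<^sub>R v) + r *\<^sub>R v)) has_vector_derivative g (z + t *\<^sub>R v)) (at (t - t))"
    using assms by (simp add: has_pderiv_def)
  moreover have "((\<lambda>r. r - t) has_vector_derivative 1) (at t)"
    by (auto intro!: derivative_eq_intros)
  ultimately have "(((\<lambda>r. u ((z + t *\<^sub>R v) + r *\<^sub>R v)) \<circ> (\<lambda>r. r - t)) has_vector_derivative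
      1 *\<^sub>R g (z + t *\<^sub>R v)) (at t)"
    by (rule vector_diff_chain_at[rotated])
  then show ?thesis by (simp add: o_def algebra_simps)
qed

lemma has_pderiv_zero_outside:
  assumes g: "has_pderiv v u g" and S: "closed S" and u: "\<And>z. z \<notin> S \<Longrightarrow> u z = 0" and z: "z \<notin> S"
  shows "g z = 0"
proof -
  define T where "T = (\<lambda>t::real. z + t *\<^sub>R v) -` (- S)"
  have "open T"
    unfolding T_def by (rule open_vimage) (use S in \<open>auto intro!: continuous_intros\<close>)
  then have "((\<lambda>t. u (z + t *\<^sub>R v)) has_vector_derivative 0) (at 0)"
    by (rule has_vector_derivative_transform_within_open[OF has_vector_derivative_const])
      (use z u in \<open>auto simp: T_def\<close>)
  moreover have "((\<lambda>t. u (z + t *\<^sub>R v)) has_vector_derivative g z) (at 0)"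
    using g by (simp add: has_pderiv_def)
  ultimately show ?thesis by (rule vector_derivative_unique_at[symmetric])
qed

lemma integrable_compact_support:
  fixes F :: "complex \<Rightarrow> complex"
  assumes F: "continuous_on UNIV F" and S: "compact S" and z: "\<And>z. z \<notin> S \<Longrightarrow> F z = 0"
  shows "integrable lborel F"
proof -
  have "integrable lborel (\<lambda>x. indicator S x *\<^sub>R F x)"
    by (rule borel_integrable_compact[OF S continuous_on_subset[OF F]]) auto
  also have "(\<lambda>x. indicator S x *\<^sub>R F x) = F" using z by (auto simp: fun_eq_iff indicator_def)
  finally show ?thesis .
qed

lemma lborel_integral_shift:
  fixes F :: "complex \<Rightarrow> complex"
  assumes F: "continuous_on UNIV F"
  shows "(LINT z|lborel. F (z + a)) = (LINT z|lborel. F z)"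
proof -
  have "(LINT z|lborel. F z) = (LINT z|distr lborel borel ((+) a). F z)"
    by (simp add: lborel_distr_plus)
  also have "\<dots> = (LINT z|lborel. F (a + z))"
    by (rule integral_distr) (use F in \<open>auto intro: borel_measurable_continuous_onI\<close>)
  finally show ?thesis by (simp add: add.commute)
qed

text \<open>Translation invariance of Lebesgue measure replaces Fubini, so any direction v is
  treated at once, without splitting the plane into coordinates.\<close>

lemma integral_pderiv_eq_0:
  assumes F: "continuous_on UNIV F" and F': "has_pderiv v F F'" "continuous_on UNIV F'"
    and S: "compact S" and S0: "\<And>z. z \<notin> S \<Longrightarrow> F z = 0"
  shows "(LINT z|lborel. F' z) = 0"
proof -
  have S0': "F' z = 0" if "z \<notin> S" for z
    using has_pderiv_zero_outside[OF F'(1) compact_imp_closed[OF S] S0 that] .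
  from compact_imp_bounded[OF S] obtain R where R: "\<And>z. z \<in> S \<Longrightarrow> norm z \<le> R"
    by (auto simp: bounded_iff)
  have "compact (F' ` S)" by (intro compact_continuous_image continuous_on_subset[OF F'(2)] S) auto
  from compact_imp_bounded[OF this] obtain M0 where M0: "\<And>z. z \<in> S \<Longrightarrow> norm (F' z) \<le> M0"
    by (auto simp: bounded_iff)
  define M where "M = max M0 0"
  have M: "norm (F' z) \<le> M" for z
    using M0[of z] S0'[of z] by (cases "z \<in> S") (auto simp: M_def)
  define h where "h k = inverse (real (Suc k))" for k
  have h: "0 < h k" "h k \<le> 1" for k by (auto simp: h_def field_simps)
  \<comment> \<open>The difference quotients have integral \<open>0\<close> by translation invariance and converge dominatedly to \<open>F'\<close>.\<close>
  define D where "D k z = inverse (h k) *\<^sub>R (F (z + h k *\<^sub>R v) - F z)" for k z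
  have Fm: "F \<in> borel_measurable lborel" "F' \<in> borel_measurable lborel"
    using F F'(2) by (auto intro: borel_measurable_continuous_onI)
  have Fsc: "continuous_on UNIV (\<lambda>z. F (z + a))" for a
    by (intro continuous_on_compose2[OF F] continuous_intros) auto
  have Fi: "integrable lborel F" by (rule integrable_compact_support[OF F S S0])
  have Fsi: "integrable lborel (\<lambda>z. F (z + a))" for a
  proof (rule integrable_compact_support[OF Fsc])
    show "compact ((\<lambda>z. z - a) ` S)"
      by (intro compact_continuous_image continuous_intros S)
    show "F (z + a) = 0" if "z \<notin> (\<lambda>z. z - a) ` S" for z
      by (rule S0) (use that image_eqI[of z "\<lambda>z. z - a" "z + a" S] in auto)
  qed
  have D0: "(LINT z|lborel. D k z) = 0" for k
    unfolding D_def by (simp add: Fi Fsi lborel_integral_shift[OF F])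
  have lim: "(\<lambda>k. D k z) \<longlonglongrightarrow> F' z" for z
  proof -
    have "((\<lambda>t. F (z + t *\<^sub>R v)) has_vector_derivative F' z) (at 0)"
      using F'(1) by (simp add: has_pderiv_def)
    then have "((\<lambda>t. norm (F (z + t *\<^sub>R v) - F z - t *\<^sub>R F' z) / \<bar>t\<bar>) \<longlongrightarrow> 0) (at 0)"
      by (simp add: has_derivative_at has_vector_derivative_def)
    moreover have "filterlim h (at 0) sequentially"
      unfolding filterlim_at h_def using LIMSEQ_inverse_real_of_nat by (simp del: of_nat_Suc)
    ultimately have "(\<lambda>k. norm (F (z + h k *\<^sub>R v) - F z - h k *\<^sub>R F' z) / \<bar>h k\<bar>) \<longlonglongrightarrow> 0"
      by (rule filterlim_compose)
    moreover have "norm (F (z + h k *\<^sub>R v) - F z - h k *\<^sub>R F' z) / \<bar>h k\<bar> = norm (D k z - F' z)" for k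
    proof -
      have "D k z - F' z = inverse (h k) *\<^sub>R (F (z + h k *\<^sub>R v) - F z - h k *\<^sub>R F' z)"
        using h[of k] by (simp add: D_def scaleR_diff_right)
      then show ?thesis by (simp add: divide_inverse mult.commute)
    qed
    ultimately have "(\<lambda>k. D k z - F' z) \<longlonglongrightarrow> 0" by (simp add: tendsto_norm_zero_iff)
    then show ?thesis by (simp add: LIM_zero_iff)
  qed
  \<comment> \<open>As h \<le> 1, translation moves the support by at most |v|, so all quotients
    vanish outside one ball; inside it, the mean value inequality bounds them by M.\<close>
  have bd: "norm (D k z) \<le> M * indicator (cball 0 (R + norm v)) z" for k z
  proof (cases "norm z \<le> R + norm v")
    case True
    have "\<exists>x\<in>{0<..<h k}. norm (F (z + h k *\<^sub>R v) - F (z + 0 *\<^sub>R v))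
        \<le> norm ((h k - 0) *\<^sub>R F' (z + x *\<^sub>R v))"
    proof (rule mvt_general[OF h(1)])
      show "continuous_on {0..h k} (\<lambda>t. F (z + t *\<^sub>R v))"
        by (intro continuous_on_compose2[OF F] continuous_intros) auto
      show "((\<lambda>t. F (z + t *\<^sub>R v)) has_derivative (\<lambda>r. r *\<^sub>R F' (z + x *\<^sub>R v))) (at x)" for x
        using has_pderiv_line[OF F'(1)] by (simp add: has_vector_derivative_def)
    qed
    then obtain x where "norm (F (z + h k *\<^sub>R v) - F z) \<le> h k * norm (F' (z + x *\<^sub>R v))"
      using h[of k] by auto
    also have "\<dots> \<le> h k * M" by (intro mult_left_mono M) (use h[of k] in auto)
    finally have "norm (D k z) \<le> M"
      using h[of k] by (simp add: D_def inverse_eq_divide pos_divide_le_eq mult.commute)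
    with True show ?thesis by simp
  next
    case False
    have "norm z \<le> norm (z + h k *\<^sub>R v) + norm (h k *\<^sub>R v)"
      using norm_triangle_ineq4[of "z + h k *\<^sub>R v" "h k *\<^sub>R v"] by simp
    also have "norm (h k *\<^sub>R v) \<le> norm v" using h[of k] by (simp add: mult_left_le_one_le)
    finally have "R < norm (z + h k *\<^sub>R v)" using False by simp
    moreover have "R < norm z" using False norm_ge_zero[of v] by linarith
    ultimately have "F (z + h k *\<^sub>R v) = 0" "F z = 0" using R S0 by (meson not_le)+
    then show ?thesis by (simp add: D_def M_def)
  qed
  have "(\<lambda>k. LINT z|lborel. D k z) \<longlonglongrightarrow> (LINT z|lborel. F' z)"
  proof (rule integral_dominated_convergence)
    show "integrable lborel (\<lambda>z. M * indicator (cball 0 (R + norm v)) z :: real)"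
      by (intro integrable_mult_right integrable_real_indicator emeasure_lborel_cball_finite) auto
    show "D k \<in> borel_measurable lborel" for k
      unfolding D_def[abs_def]
      using Fm(1) Fsc by (intro borel_measurable_scaleR borel_measurable_diff borel_measurable_const)
        (auto intro: borel_measurable_continuous_onI)
  qed (use Fm lim bd in auto)
  then show ?thesis by (simp add: D0 LIMSEQ_const_iff)
qed

section \<open>Weak derivatives of classically differentiable functions\<close>

lemma differentiable_has_pderiv:
  assumes "\<phi> differentiable_on UNIV"
  shows "has_pderiv v \<phi> (pderiv_dir v \<phi>)"
  unfolding has_pderiv_def pderiv_dir_def
proof
  fix z
  have "(\<lambda>t::real. \<phi> (z + t *\<^sub>R v)) differentiable (at 0)"
  proof (rule differentiable_chain_at[of "\<lambda>t. z + t *\<^sub>R v" 0 \<phi>, unfolded o_def])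
    show "(\<lambda>t::real. z + t *\<^sub>R v) differentiable (at 0)"
      by (intro derivative_intros)
    show "\<phi> differentiable (at (z + 0 *\<^sub>R v))"
      using assms by (simp add: differentiable_on_def)
  qed
  then show "((\<lambda>t. \<phi> (z + t *\<^sub>R v)) has_vector_derivative
      vector_derivative (\<lambda>t. \<phi> (z + t *\<^sub>R v)) (at 0)) (at 0)"
    by (simp add: vector_derivative_works)
qed

lemma C_diff_continuous: "C_diff k \<phi> \<Longrightarrow> continuous_on UNIV \<phi>"
  by (cases k) (auto dest: differentiable_imp_continuous_on)

lemma test_function_has_pderiv: "test_function \<phi> \<Longrightarrow> has_pderiv v \<phi> (pderiv_dir v \<phi>)"
  unfolding test_function_def by (metis C_diff.simps(2) differentiable_has_pderiv)

lemma test_function_continuous: "test_function \<phi> \<Longrightarrow> continuous_on UNIV \<phi>"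
  unfolding test_function_def using C_diff_continuous by blast

text \<open>Only the coordinate directions occur because \<open>C_diff\<close> iterates
  \<open>dx\<close> and \<open>dy\<close>. Differentiation does not enlarge the closed
  support.\<close>

lemma test_function_pderiv:
  assumes "test_function \<phi>" and v: "v = 1 \<or> v = \<i>"
  shows "test_function (pderiv_dir v \<phi>)"
  unfolding test_function_def
proof
  from assms(1) have C: "C_diff (Suc k) \<phi>" for k by (auto simp only: test_function_def)
  show "\<forall>k. C_diff k (pderiv_dir v \<phi>)" using C v by auto
  let ?S = "closure {z. \<phi> z \<noteq> 0}"
  have S: "compact ?S" using assms by (simp add: test_function_def)
  have "pderiv_dir v \<phi> z = 0" if "z \<notin> ?S" for z
  proof (rule has_pderiv_zero_outside[OF test_function_has_pderiv[OF assms(1)] closed_closure _ that])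
    show "\<phi> z = 0" if "z \<notin> ?S" for z
      using that closure_subset[of "{z. \<phi> z \<noteq> 0}"] by auto
  qed
  then have "closure {z. pderiv_dir v \<phi> z \<noteq> 0} \<subseteq> ?S"
    by (intro closure_minimal) auto
  from compact_Int_closed[OF S closed_closure[of "{z. pderiv_dir v \<phi> z \<noteq> 0}"]] this
  show "compact (closure {z. pderiv_dir v \<phi> z \<noteq> 0})" by (simp add: Int_absorb1)
qed

lemma integrable_mult_test_function:
  assumes u: "continuous_on UNIV u" and \<phi>: "test_function \<phi>"
  shows "integrable lborel (\<lambda>z. u z * \<phi> z)"
proof (rule integrable_compact_support)
  show "continuous_on UNIV (\<lambda>z. u z * \<phi> z)"
    by (intro continuous_intros u test_function_continuous \<phi>)
  show "compact (closure {z. \<phi> z \<noteq> 0})" using \<phi> by (simp add: test_function_def)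
  show "u z * \<phi> z = 0" if "z \<notin> closure {z. \<phi> z \<noteq> 0}" for z
    using that closure_subset[of "{z. \<phi> z \<noteq> 0}"] by auto
qed

text \<open>The product u \<phi> has compact support, so the integral of its derivative vanishes;
  the product rule splits it into the two sides.\<close>

lemma weak_pderiv_classical:
  assumes u: "continuous_on UNIV u" and g: "has_pderiv v u g" "continuous_on UNIV g"
    and v: "v = 1 \<or> v = \<i>"
  shows "weak_pderiv v u g"
  unfolding weak_pderiv_def
proof (intro allI impI)
  fix \<phi> assume \<phi>: "test_function \<phi>"
  let ?d = "pderiv_dir v \<phi>"
  have d: "test_function ?d" by (rule test_function_pderiv[OF \<phi> v])
  have "(LINT z|lborel. u z * ?d z + g z * \<phi> z) = 0"
  proof (rule integral_pderiv_eq_0)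
    show "has_pderiv v (\<lambda>z. u z * \<phi> z) (\<lambda>z. u z * ?d z + g z * \<phi> z)"
      by (intro has_pderiv_mult g test_function_has_pderiv \<phi>)
    show "compact (closure {z. \<phi> z \<noteq> 0})" using \<phi> by (simp add: test_function_def)
    show "u z * \<phi> z = 0" if "z \<notin> closure {z. \<phi> z \<noteq> 0}" for z
      using that closure_subset[of "{z. \<phi> z \<noteq> 0}"] by auto
  qed (intro continuous_intros u g test_function_continuous \<phi> d)+
  also have "(LINT z|lborel. u z * ?d z + g z * \<phi> z) =
      (LINT z|lborel. u z * ?d z) + (LINT z|lborel. g z * \<phi> z)"
    by (intro Bochner_Integration.integral_add integrable_mult_test_function u g \<phi> d)
  finally show "(LINT z|lborel. u z * ?d z) = - (LINT z|lborel. g z * \<phi> z)"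
    by (simp add: eq_neg_iff_add_eq_0)
qed

text \<open>Two integrations by parts in each direction, whose signs cancel.\<close>

lemma weak_laplacian_classical:
  assumes u: "continuous_on UNIV u"
    and x: "has_pderiv 1 u ux" "continuous_on UNIV ux" "has_pderiv 1 ux uxx" "continuous_on UNIV uxx"
    and y: "has_pderiv \<i> u uy" "continuous_on UNIV uy" "has_pderiv \<i> uy uyy" "continuous_on UNIV uyy"
  shows "weak_laplacian u (\<lambda>z. uxx z + uyy z)"
  unfolding weak_laplacian_def laplacian_def
proof (intro allI impI)
  fix \<phi> assume \<phi>: "test_function \<phi>"
  have twice: "(LINT z|lborel. u z * pderiv_dir v (pderiv_dir v \<phi>) z) = (LINT z|lborel. g' z * \<phi> z)"
    if "has_pderiv v u g" "continuous_on UNIV g" "has_pderiv v g g'" "continuous_on UNIV g'"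
      "v = 1 \<or> v = \<i>" for v g g'
    using weak_pderiv_classical[OF u that(1,2,5)] weak_pderiv_classical[OF that(2-5)]
      \<phi> test_function_pderiv[OF \<phi> that(5)]
    by (simp add: weak_pderiv_def)
  have d: "test_function (dx (dx \<phi>))" "test_function (dy (dy \<phi>))"
    by (intro test_function_pderiv \<phi>; simp)+
  have "(LINT z|lborel. u z * (dx (dx \<phi>) z + dy (dy \<phi>) z)) =
      (LINT z|lborel. u z * dx (dx \<phi>) z) + (LINT z|lborel. u z * dy (dy \<phi>) z)"
    unfolding distrib_left
    by (intro Bochner_Integration.integral_add integrable_mult_test_function u d)
  also have "\<dots> = (LINT z|lborel. uxx z * \<phi> z) + (LINT z|lborel. uyy z * \<phi> z)"
    using twice[OF x] twice[OF y] by simp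
  also have "\<dots> = (LINT z|lborel. (uxx z + uyy z) * \<phi> z)"
    unfolding distrib_right
    by (intro Bochner_Integration.integral_add[symmetric] integrable_mult_test_function x y \<phi>)
  finally show "(LINT z|lborel. u z * (dx (dx \<phi>) z + dy (dy \<phi>) z)) =
      (LINT z|lborel. (uxx z + uyy z) * \<phi> z)" .
qed

section \<open>Square integrability from pointwise decay\<close>

lemma integrable_inverse_quartic:
  "integrable lborel (\<lambda>z::complex. 1 / (1 + norm z) ^ 4)"
proof (rule integrableI_bounded)
  \<comment> \<open>Compare with the step function that is \<open>1 / (k + 1)\<^sup>4\<close> on the \<open>k\<close>-th unit annulus.\<close>
  have "(\<integral>\<^sup>+ z. ennreal (norm (1 / (1 + norm z) ^ 4)) \<partial>(lborel :: complex measure))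
      \<le> (\<integral>\<^sup>+ z. (\<Sum>k. ennreal (1 / (real (Suc k)) ^ 4) * indicator (ball 0 (real (Suc k))) z) \<partial>(lborel :: complex measure))"
  proof (rule nn_integral_mono)
    fix z :: complex
    define k where "k = nat \<lfloor>norm z\<rfloor>"
    have "real k = of_int \<lfloor>norm z\<rfloor>" by (simp add: k_def)
    then have k: "real k \<le> norm z" "norm z < real (Suc k)"
      using floor_correct[of "norm z"] by linarith+
    have "1 / (1 + norm z) ^ 4 \<le> 1 / (real (Suc k)) ^ 4"
      by (intro divide_left_mono power_mono) (use k in auto)
    then have "ennreal (norm (1 / (1 + norm z) ^ 4)) \<le>
        ennreal (1 / (real (Suc k)) ^ 4) * indicator (ball 0 (real (Suc k))) z"
      using k by (auto simp: ennreal_leI)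
    also have "\<dots> \<le> (\<Sum>k. ennreal (1 / (real (Suc k)) ^ 4) * indicator (ball 0 (real (Suc k))) z)"
    proof -
      have "h k \<le> (\<Sum>k. h k)" for h :: "nat \<Rightarrow> ennreal"
        using sum_le_suminf[of h "{k}"] by simp
      then show ?thesis .
    qed
    finally show "ennreal (norm (1 / (1 + norm z) ^ 4)) \<le>
      (\<Sum>k. ennreal (1 / (real (Suc k)) ^ 4) * indicator (ball 0 (real (Suc k))) z)" .
  qed
  also have "\<dots> = (\<Sum>k. \<integral>\<^sup>+ z. ennreal (1 / (real (Suc k)) ^ 4) * indicator (ball 0 (real (Suc k))) z
      \<partial>(lborel :: complex measure))"
    by (intro nn_integral_suminf borel_measurable_times_ennreal borel_measurable_indicator) auto
  \<comment> \<open>The area of the ball cancels two of the four powers, leaving the convergent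
    series of inverse squares.\<close>
  also have "\<dots> = (\<Sum>k. ennreal (unit_ball_vol 2 * (1 / (real (Suc k))\<^sup>2)))"
  proof (intro suminf_cong)
    fix k
    have "(\<integral>\<^sup>+ z. ennreal (1 / (real (Suc k)) ^ 4) * indicator (ball 0 (real (Suc k))) z
      \<partial>(lborel :: complex measure)) =
      ennreal (1 / (real (Suc k)) ^ 4) * emeasure lborel (ball (0::complex) (real (Suc k)))"
      by (subst nn_integral_cmult_indicator) auto
    also have "\<dots> = ennreal (1 / (real (Suc k)) ^ 4 * (unit_ball_vol 2 * real (Suc k) ^ 2))"
      by (subst emeasure_ball) (auto simp flip: ennreal_mult' simp del: of_nat_Suc)
    also have "1 / (real (Suc k)) ^ 4 * (unit_ball_vol 2 * real (Suc k) ^ 2) =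
        unit_ball_vol 2 * (1 / (real (Suc k))\<^sup>2)"
      by (simp add: field_simps power2_eq_square power4_eq_xxxx del: of_nat_Suc)
    finally show "(\<integral>\<^sup>+ z. ennreal (1 / (real (Suc k)) ^ 4) * indicator (ball 0 (real (Suc k))) z
      \<partial>(lborel :: complex measure)) = ennreal (unit_ball_vol 2 * (1 / (real (Suc k))\<^sup>2))" .
  qed
  also have "\<dots> < \<infinity>"
  proof -
    have "summable (\<lambda>k. unit_ball_vol 2 * (1 / (real (Suc k))\<^sup>2))"
      using inverse_squares_sums by (intro summable_mult) (auto simp: sums_iff add.commute)
    then have "(\<Sum>k. ennreal (unit_ball_vol 2 * (1 / (real (Suc k))\<^sup>2))) \<noteq> top"
      by (intro ennreal_suminf_neq_top) auto
    then show ?thesis by (simp add: top.not_eq_extremum)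
  qed
  finally show "(\<integral>\<^sup>+ z. ennreal (norm (1 / (1 + norm z) ^ 4)) \<partial>(lborel :: complex measure)) < \<infinity>" .
qed simp

lemma L2_cmult:
  assumes "u \<in> L2" shows "(\<lambda>z. c * u z) \<in> L2"
  using assms by (auto simp: L2_def norm_mult power_mult_distrib)

text \<open>The set where u is nonzero is open, and a nonempty open set is not negligible.\<close>

lemma continuous_AE_eq_0_imp_eq_0:
  fixes u :: "complex \<Rightarrow> complex"
  assumes u: "continuous_on UNIV u" and 0: "AE z in lborel. u z = 0"
  shows "u z = 0"
proof (rule ccontr)
  let ?S = "{z::complex. u z \<noteq> 0}"
  assume "u z \<noteq> 0"
  moreover have S: "open ?S"
    using u by (intro open_Collect_neq) auto
  ultimately have "\<not> negligible ?S" by (intro open_not_negligible) auto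
  moreover have "?S \<in> null_sets lborel"
    using 0 S by (subst AE_iff_null_sets) (auto simp: borel_open)
  then have "negligible ?S" by (simp add: negligible_iff_null_sets null_sets_completionI)
  ultimately show False by simp
qed

lemma L2_decay:
  assumes u: "continuous_on UNIV u" and C: "\<And>z. norm (u z) \<le> C / (1 + norm z)\<^sup>2"
  shows "u \<in> L2"
  unfolding L2_def
proof (intro CollectI conjI)
  show um: "u \<in> borel_measurable lborel"
    using u by (auto intro: borel_measurable_continuous_onI)
  show "integrable lborel (\<lambda>z. (cmod (u z))\<^sup>2)"
  proof (rule Bochner_Integration.integrable_bound)
    show "integrable lborel (\<lambda>z::complex. C\<^sup>2 * (1 / (1 + norm z) ^ 4))"
      by (intro integrable_mult_right integrable_inverse_quartic)
    have "(cmod (u z))\<^sup>2 \<le> C\<^sup>2 * (1 / (1 + cmod z) ^ 4)" for z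
    proof -
      have "(cmod (u z))\<^sup>2 \<le> (C / (1 + norm z)\<^sup>2)\<^sup>2" by (rule power_mono[OF C]) simp
      then show ?thesis by (simp add: power_divide flip: power_mult)
    qed
    then show "AE z in lborel. norm ((cmod (u z))\<^sup>2) \<le> norm (C\<^sup>2 * (1 / (1 + cmod z) ^ 4))"
      by (auto intro!: AE_I2 order_trans[OF _ abs_ge_self])
  qed (use um in measurable)
qed

section \<open>Radial functions in the Sobolev space\<close>

text \<open>Along a line |z + t v|^2 is a quadratic polynomial in t with values in [0, \<infinity>).
  Hence a one-sided derivative of g at 0 is enough and the origin needs no separate
  treatment.\<close>

lemma has_pderiv_radial:
  assumes g: "\<And>s. 0 \<le> s \<Longrightarrow> (g has_real_derivative g' s) (at s within {0..})"
  shows "has_pderiv v (\<lambda>z. of_real (g ((cmod z)\<^sup>2))) (\<lambda>z. of_real (2 * (z \<bullet> v) * g' ((cmod z)\<^sup>2)))"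
  unfolding has_pderiv_def
proof
  fix z
  have sq: "(cmod (z + t *\<^sub>R v))\<^sup>2 = (cmod z)\<^sup>2 + 2 * t * (z \<bullet> v) + t\<^sup>2 * (cmod v)\<^sup>2" for t
    unfolding power2_norm_eq_inner
    by (simp add: inner_add_left inner_add_right inner_commute[of v z] power2_eq_square algebra_simps)
  have "((\<lambda>t. g ((cmod (z + t *\<^sub>R v))\<^sup>2)) has_real_derivative g' ((cmod (z + 0 *\<^sub>R v))\<^sup>2) * (2 * (z \<bullet> v))) (at 0)"
  proof (rule DERIV_image_chain[of g _ "\<lambda>t. (cmod (z + t *\<^sub>R v))\<^sup>2" 0 UNIV, unfolded o_def])
    show "(g has_real_derivative g' ((cmod (z + 0 *\<^sub>R v))\<^sup>2))
        (at ((cmod (z + 0 *\<^sub>R v))\<^sup>2) within range (\<lambda>t. (cmod (z + t *\<^sub>R v))\<^sup>2))"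
      by (rule has_field_derivative_subset[OF g]) auto
    show "((\<lambda>t. (cmod (z + t *\<^sub>R v))\<^sup>2) has_real_derivative 2 * (z \<bullet> v)) (at 0)"
      unfolding sq by (auto intro!: derivative_eq_intros)
  qed
  then have "((\<lambda>t. g ((cmod (z + t *\<^sub>R v))\<^sup>2)) has_real_derivative 2 * (z \<bullet> v) * g' ((cmod z)\<^sup>2)) (at 0)"
    by (simp add: mult_ac)
  then show "((\<lambda>t. of_real (g ((cmod (z + t *\<^sub>R v))\<^sup>2))) has_vector_derivative
      of_real (2 * (z \<bullet> v) * g' ((cmod z)\<^sup>2))) (at 0)"
    by (rule has_vector_derivative_of_real)
qed

lemma has_pderiv_radial_twice:
  assumes g': "\<And>s. 0 \<le> s \<Longrightarrow> (g' has_real_derivative g'' s) (at s within {0..})"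
  shows "has_pderiv w (\<lambda>z. of_real (2 * (z \<bullet> v) * g' ((cmod z)\<^sup>2)))
     (\<lambda>z. of_real (2 * (w \<bullet> v) * g' ((cmod z)\<^sup>2) + 4 * (z \<bullet> v) * (z \<bullet> w) * g'' ((cmod z)\<^sup>2)))"
proof -
  have "has_pderiv w (\<lambda>z. of_real (z \<bullet> (2 *\<^sub>R v)) * of_real (g' ((cmod z)\<^sup>2)))
     (\<lambda>z. of_real (z \<bullet> (2 *\<^sub>R v)) * of_real (2 * (z \<bullet> w) * g'' ((cmod z)\<^sup>2)) +
          of_real (w \<bullet> (2 *\<^sub>R v)) * of_real (g' ((cmod z)\<^sup>2)))"
    by (intro has_pderiv_mult has_pderiv_inner has_pderiv_radial g')
  then show ?thesis
    \<comment> \<open>The function and its derivative are replaced simultaneously, as a pair, by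
      algebraically equal expressions.\<close>
    by (rule back_subst[of "\<lambda>(u, g). has_pderiv w u g" "(_, _)" "(_, _)", unfolded prod.case])
      (auto simp: fun_eq_iff algebra_simps)
qed

lemma continuous_radial:
  fixes g :: "real \<Rightarrow> real"
  assumes "continuous_on {0..} g"
  shows "continuous_on UNIV (\<lambda>z. g ((cmod z)\<^sup>2))"
  by (rule continuous_on_compose2[OF assms]) (auto intro!: continuous_intros)

lemma one_plus_norm_sq_le: "(1 + cmod z)\<^sup>2 \<le> 2 * (1 + (cmod z)\<^sup>2)"
  using zero_le_power2[of "1 - cmod z"] by (simp add: power2_eq_square algebra_simps)

text \<open>The allowed growth factor 1 + |z|^2 absorbs the polynomial factors produced by the chain
  rule; one power of 1 + |z|^2 remains in the denominator and is comparable to (1 + |z|)^2.\<close>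

lemma radial_L2:
  assumes g: "\<And>s. 0 \<le> s \<Longrightarrow> \<bar>g s\<bar> \<le> C / (1 + s)\<^sup>2"
    and u: "continuous_on UNIV u" and b: "\<And>z. cmod (u z) \<le> D * (1 + (cmod z)\<^sup>2) * \<bar>g ((cmod z)\<^sup>2)\<bar>" and D: "0 \<le> D"
  shows "u \<in> L2"
proof (rule L2_decay[OF u])
  fix z
  define s where "s = (cmod z)\<^sup>2"
  have s: "0 \<le> s" by (simp add: s_def)
  have "0 \<le> \<bar>g 0\<bar>" by simp
  also have "\<bar>g 0\<bar> \<le> C" using g[of 0] by simp
  finally have C: "0 \<le> C" .
  have "cmod (u z) \<le> D * (1 + s) * (C / (1 + s)\<^sup>2)"
    using b[of z] mult_left_mono[OF g[OF s], of "D * (1 + s)"] D s by (simp add: s_def)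
  also have "\<dots> = C * D / (1 + s)" using s by (simp add: power2_eq_square)
  also have "\<dots> \<le> 2 * C * D / (1 + cmod z)\<^sup>2"
  proof -
    have "0 < 1 + s" "0 < (1 + cmod z)\<^sup>2" using s add_pos_nonneg[of 1 "cmod z"] by auto
    moreover have "C * D * (1 + cmod z)\<^sup>2 \<le> C * D * (2 * (1 + s))"
      unfolding s_def by (intro mult_left_mono one_plus_norm_sq_le mult_nonneg_nonneg C D)
    ultimately show ?thesis by (simp add: pos_divide_le_eq pos_le_divide_eq mult_ac)
  qed
  finally show "cmod (u z) \<le> 2 * C * D / (1 + cmod z)\<^sup>2" .
qed

locale radial_H2 =
  fixes g g' g'' :: "real \<Rightarrow> real" and C :: real
  assumes g: "\<And>s. 0 \<le> s \<Longrightarrow> (g has_real_derivative g' s) (at s within {0..})"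
    and g': "\<And>s. 0 \<le> s \<Longrightarrow> (g' has_real_derivative g'' s) (at s within {0..})"
    and g''_cont: "continuous_on {0..} g''"
    and g_le: "\<And>s. 0 \<le> s \<Longrightarrow> \<bar>g s\<bar> \<le> C / (1 + s)\<^sup>2"
    and g'_le: "\<And>s. 0 \<le> s \<Longrightarrow> \<bar>g' s\<bar> \<le> C / (1 + s)\<^sup>2"
    and g''_le: "\<And>s. 0 \<le> s \<Longrightarrow> \<bar>g'' s\<bar> \<le> C / (1 + s)\<^sup>2"
begin

definition U :: "complex \<Rightarrow> complex" where "U z = of_real (g ((cmod z)\<^sup>2))"
definition U1 :: "complex \<Rightarrow> complex \<Rightarrow> complex" where
  "U1 v z = of_real (2 * (z \<bullet> v) * g' ((cmod z)\<^sup>2))"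
definition U2 :: "complex \<Rightarrow> complex \<Rightarrow> complex \<Rightarrow> complex" where
  "U2 v w z = of_real (2 * (w \<bullet> v) * g' ((cmod z)\<^sup>2) + 4 * (z \<bullet> v) * (z \<bullet> w) * g'' ((cmod z)\<^sup>2))"

lemma U_pderiv: "has_pderiv v U (U1 v)"
  unfolding U_def[abs_def] U1_def[abs_def] by (rule has_pderiv_radial[OF g])

lemma U1_pderiv: "has_pderiv w (U1 v) (U2 v w)"
  unfolding U1_def[abs_def] U2_def[abs_def] by (rule has_pderiv_radial_twice[OF g'])

lemma g_cont: "continuous_on {0..} g" and g'_cont: "continuous_on {0..} g'"
  by (rule DERIV_continuous_on, use g in force) (rule DERIV_continuous_on, use g' in force)

lemma U_cont: "continuous_on UNIV U"
  unfolding U_def[abs_def] by (intro continuous_intros continuous_radial g_cont)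

lemma U1_cont: "continuous_on UNIV (U1 v)"
  unfolding U1_def[abs_def] by (intro continuous_intros continuous_radial g'_cont)

lemma U2_cont: "continuous_on UNIV (U2 v w)"
  unfolding U2_def[abs_def] by (intro continuous_intros continuous_radial g'_cont g''_cont)

lemma U_L2: "U \<in> L2"
proof (rule radial_L2[OF g_le U_cont])
  show "cmod (U z) \<le> 1 * (1 + (cmod z)\<^sup>2) * \<bar>g ((cmod z)\<^sup>2)\<bar>" for z
    using mult_right_mono[of 1 "1 + (cmod z)\<^sup>2" "\<bar>g ((cmod z)\<^sup>2)\<bar>"] by (simp add: U_def)
qed auto

lemma inner_le:
  assumes "cmod v \<le> 1" shows "\<bar>z \<bullet> v\<bar> \<le> cmod z"
  using Cauchy_Schwarz_ineq2[of z v] mult_left_le[OF assms, of "cmod z"] by simp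

lemma U1_L2: assumes v: "cmod v \<le> 1" shows "U1 v \<in> L2"
proof (rule radial_L2[OF g'_le U1_cont])
  fix z
  have "2 * \<bar>z \<bullet> v\<bar> \<le> 1 + (cmod z)\<^sup>2"
    using inner_le[OF v, of z] zero_le_power2[of "1 - cmod z"] by (simp add: power2_eq_square algebra_simps)
  from mult_right_mono[OF this, of "\<bar>g' ((cmod z)\<^sup>2)\<bar>"]
  show "cmod (U1 v z) \<le> 1 * (1 + (cmod z)\<^sup>2) * \<bar>g' ((cmod z)\<^sup>2)\<bar>"
    by (simp add: U1_def norm_mult abs_mult)
qed auto

text \<open>The outer absolute value gives the bound the shape that \<open>radial_L2\<close>
  expects, with the single profile |g'| + |g''| for all second derivatives.\<close>

lemma g'_g''_le: "0 \<le> s \<Longrightarrow> \<bar>\<bar>g' s\<bar> + \<bar>g'' s\<bar>\<bar> \<le> 2 * C / (1 + s)\<^sup>2"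
  using g'_le[of s] g''_le[of s] by simp

lemma U2_le:
  assumes v: "cmod v \<le> 1" "cmod w \<le> 1"
  shows "cmod (U2 v w z) \<le> 4 * (1 + (cmod z)\<^sup>2) * \<bar>\<bar>g' ((cmod z)\<^sup>2)\<bar> + \<bar>g'' ((cmod z)\<^sup>2)\<bar>\<bar>"
proof -
  define s where "s = (cmod z)\<^sup>2"
  have s: "0 \<le> s" by (simp add: s_def)
  have 1: "\<bar>w \<bullet> v\<bar> \<le> 1" using inner_le[OF v(1), of w] v(2) by linarith
  have 2: "\<bar>z \<bullet> v\<bar> * \<bar>z \<bullet> w\<bar> \<le> s"
    unfolding s_def power2_eq_square by (intro mult_mono inner_le v) auto
  have "cmod (U2 v w z) \<le> \<bar>2 * (w \<bullet> v) * g' s\<bar> + \<bar>4 * (z \<bullet> v) * (z \<bullet> w) * g'' s\<bar>"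
    unfolding U2_def s_def norm_of_real by (rule abs_triangle_ineq)
  also have "\<dots> = (2 * \<bar>w \<bullet> v\<bar>) * \<bar>g' s\<bar> + (4 * (\<bar>z \<bullet> v\<bar> * \<bar>z \<bullet> w\<bar>)) * \<bar>g'' s\<bar>"
    by (simp add: abs_mult mult_ac)
  also have "\<dots> \<le> (4 * (1 + s)) * \<bar>g' s\<bar> + (4 * (1 + s)) * \<bar>g'' s\<bar>"
    by (intro add_mono mult_right_mono) (use 1 2 s in auto)
  finally show ?thesis by (simp add: s_def algebra_simps)
qed

lemma U2_L2:
  assumes v: "cmod v \<le> 1" "cmod w \<le> 1" shows "U2 v w \<in> L2"
  by (rule radial_L2[OF g'_g''_le U2_cont U2_le[OF v]]) auto

lemma U_sobolev: "U \<in> sobolev_H 2"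
proof -
  have U1: "U1 v \<in> sobolev_H (Suc 0)" if "cmod v \<le> 1" for v
    using U1_L2[OF that] U2_L2[OF that, of 1] U2_L2[OF that, of \<i>]
      weak_pderiv_classical[OF U1_cont U1_pderiv U2_cont, of 1 v]
      weak_pderiv_classical[OF U1_cont U1_pderiv U2_cont, of \<i> v]
    by auto
  have "\<exists>g\<in>sobolev_H (Suc 0). weak_pderiv v U g" if "v = 1 \<or> v = \<i>" for v
    using weak_pderiv_classical[OF U_cont U_pderiv U1_cont that] U1[of v] that by force
  then show ?thesis using U_L2 by (simp add: numeral_2_eq_2 del: sobolev_H.simps(1))
qed

text \<open>Over the directions 1 and \<i> the squares of z \<bullet> v add up to |z|^2, so
  \<Delta>U = 4 (g' + s g'') = 4 (l - v) U, and the potential -4 v cancels the v-term of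
  -\<Delta>U.\<close>

lemma U_eigenfunction:
  assumes ode: "\<And>s. 0 \<le> s \<Longrightarrow> g' s + s * g'' s = (l - v s) * g s" and g0: "g 0 \<noteq> 0"
    and V: "\<And>z. V z = of_real (- 4 * v ((cmod z)\<^sup>2))"
  shows "eigenvalue (schrodinger V) (of_real (- 4 * l))"
  unfolding eigenvalue_def schrodinger_def
proof (intro exI conjI)
  let ?L = "\<lambda>z. U2 1 1 z + U2 \<i> \<i> z"
  have L: "?L z = of_real (4 * (l - v ((cmod z)\<^sup>2))) * U z" for z
  proof -
    define q where "q = g'' ((cmod z)\<^sup>2)"
    have "(z \<bullet> 1) * (z \<bullet> 1) + (z \<bullet> \<i>) * (z \<bullet> \<i>) = (cmod z)\<^sup>2"
      by (simp add: cmod_power2 inner_complex_def flip: power2_eq_square)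
    moreover have "2 * ((1::complex) \<bullet> 1) * g' ((cmod z)\<^sup>2) + 4 * (z \<bullet> 1) * (z \<bullet> 1) * q +
        (2 * (\<i> \<bullet> \<i>) * g' ((cmod z)\<^sup>2) + 4 * (z \<bullet> \<i>) * (z \<bullet> \<i>) * q) =
        4 * (g' ((cmod z)\<^sup>2) + ((z \<bullet> 1) * (z \<bullet> 1) + (z \<bullet> \<i>) * (z \<bullet> \<i>)) * q)"
      by (simp add: algebra_simps)
    ultimately have "2 * ((1::complex) \<bullet> 1) * g' ((cmod z)\<^sup>2) + 4 * (z \<bullet> 1) * (z \<bullet> 1) * g'' ((cmod z)\<^sup>2) +
        (2 * (\<i> \<bullet> \<i>) * g' ((cmod z)\<^sup>2) + 4 * (z \<bullet> \<i>) * (z \<bullet> \<i>) * g'' ((cmod z)\<^sup>2)) =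
        4 * (g' ((cmod z)\<^sup>2) + (cmod z)\<^sup>2 * g'' ((cmod z)\<^sup>2))"
      by (simp only: q_def)
    with ode[of "(cmod z)\<^sup>2"] show ?thesis
      unfolding U2_def U_def of_real_add[symmetric] of_real_mult[symmetric] by (simp add: mult_ac)
  qed
  show "U \<in> sobolev_H 2" by (rule U_sobolev)
  show "(\<lambda>z. of_real (- 4 * l) * U z) \<in> L2" by (rule L2_cmult[OF U_L2])
  show "\<exists>g\<in>L2. weak_laplacian U g \<and>
      (AE z in lborel. of_real (- 4 * l) * U z = - g z + V z * U z)"
  proof (intro bexI conjI AE_I2)
    show "weak_laplacian U ?L"
      by (rule weak_laplacian_classical[OF U_cont]) (rule U_pderiv U1_pderiv U1_cont U2_cont)+
    show "of_real (- 4 * l) * U z = - ?L z + V z * U z" for z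
      unfolding L V by (simp add: algebra_simps)
    show "?L \<in> L2"
    proof (rule radial_L2[OF g'_g''_le, where D = 8])
      show "cmod (?L z) \<le> 8 * (1 + (cmod z)\<^sup>2) * \<bar>\<bar>g' ((cmod z)\<^sup>2)\<bar> + \<bar>g'' ((cmod z)\<^sup>2)\<bar>\<bar>" for z
        using norm_triangle_le[OF add_mono[OF U2_le[of 1 1 z] U2_le[of \<i> \<i> z]]]
        by (simp add: algebra_simps)
    qed (auto intro!: continuous_intros U2_cont)
  qed
  show "\<not> (AE z in lborel. U z = 0)"
    using continuous_AE_eq_0_imp_eq_0[OF U_cont, of 0] g0 by (auto simp: U_def)
qed

end

section \<open>The potential expressed through Wirtinger derivatives\<close>

lemma dzbar_radial:
  assumes g: "\<And>s. 0 \<le> s \<Longrightarrow> (g has_real_derivative g' s) (at s within {0..})"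
  shows "dzbar (\<lambda>z. of_real (g ((cmod z)\<^sup>2))) = (\<lambda>z. z * of_real (g' ((cmod z)\<^sup>2)))"
proof
  fix z :: complex
  have "pderiv_dir v (\<lambda>z. of_real (g ((cmod z)\<^sup>2))) z = of_real (2 * (z \<bullet> v) * g' ((cmod z)\<^sup>2))" for v
    by (simp add: has_pderiv_eq[OF has_pderiv_radial[OF g]])
  then show "dzbar (\<lambda>z. of_real (g ((cmod z)\<^sup>2))) z = z * of_real (g' ((cmod z)\<^sup>2))"
    by (simp add: dzbar_def complex_eq_iff)
qed

text \<open>By the product rule for z g'(|z|^2): the z-derivative of z is 1 and that of g'(|z|^2) is
  the conjugate of z times g''(|z|^2).\<close>

lemma dz_dzbar_radial:
  assumes g: "\<And>s. 0 \<le> s \<Longrightarrow> (g has_real_derivative g' s) (at s within {0..})"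
    and g': "\<And>s. 0 \<le> s \<Longrightarrow> (g' has_real_derivative g'' s) (at s within {0..})"
  shows "dz (dzbar (\<lambda>z. of_real (g ((cmod z)\<^sup>2)))) z =
    of_real (g' ((cmod z)\<^sup>2) + (cmod z)\<^sup>2 * g'' ((cmod z)\<^sup>2))"
proof -
  define a b where "a = g' ((cmod z)\<^sup>2)" and "b = g'' ((cmod z)\<^sup>2)"
  have "pderiv_dir v (\<lambda>z. z * of_real (g' ((cmod z)\<^sup>2))) z =
      z * of_real (2 * (z \<bullet> v) * b) + v * of_real a" for v
    unfolding a_def b_def
    by (simp add: has_pderiv_eq[OF has_pderiv_mult[OF has_pderiv_id has_pderiv_radial[OF g']]])
  moreover have "(cmod z)\<^sup>2 = Re z * Re z + Im z * Im z"
    by (simp add: cmod_power2 flip: power2_eq_square)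
  moreover have "dzbar (\<lambda>z. of_real (g ((cmod z)\<^sup>2))) = (\<lambda>z. z * of_real (g' ((cmod z)\<^sup>2)))"
    by (rule dzbar_radial[OF g])
  ultimately show ?thesis
    unfolding dz_def a_def[symmetric] b_def[symmetric]
    by (simp add: complex_eq_iff algebra_simps)
qed

lemma log_deriv:
  fixes s :: real
  assumes s: "0 \<le> s"
  shows "((\<lambda>s. ln (1 + s ^ Suc m)) has_real_derivative real (Suc m) * s ^ m / (1 + s ^ Suc m)) (at s within {0..})"
proof -
  define a where "a = s ^ Suc m"
  have a: "0 < 1 + a" using zero_le_power[OF s, of "Suc m"] by (simp add: a_def)
  show ?thesis
    using a
    by - (rule derivative_eq_intros power_deriv_Suc refl | simp add: a_def[symmetric] del: power_Suc of_nat_Suc)+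
qed

lemma log_deriv2:
  fixes s :: real
  assumes s: "0 \<le> s"
  shows "((\<lambda>s. real (Suc (Suc m)) * s ^ Suc m / (1 + s ^ Suc (Suc m))) has_real_derivative
    real (Suc (Suc m)) * (real (Suc m) * s ^ m * (1 + s ^ Suc (Suc m)) - s ^ Suc m * (real (Suc (Suc m)) * s ^ Suc m))
      / (1 + s ^ Suc (Suc m))\<^sup>2) (at s within {0..})"
proof -
  define a where "a = s ^ Suc (Suc m)"
  have a: "0 < 1 + a" using zero_le_power[OF s, of "Suc (Suc m)"] by (simp only: a_def)
  have "((\<lambda>s. real (Suc (Suc m)) * (s ^ Suc m / (1 + s ^ Suc (Suc m)))) has_real_derivative
    real (Suc (Suc m)) * ((real (Suc m) * s ^ m * (1 + a) - s ^ Suc m * (real (Suc (Suc m)) * s ^ Suc m))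
      / ((1 + a) * (1 + a)))) (at s within {0..})"
    using a
    by - (rule derivative_eq_intros power_deriv_Suc refl | simp add: a_def[symmetric] del: power_Suc of_nat_Suc)+
  then show ?thesis unfolding a_def by (simp add: power2_eq_square)
qed

text \<open>For G(s) = ln (1 + s^n) one has (s G')' = n^2 s^(n-1) / (1 + s^n)^2, which is half of
  \<open>pot n s\<close>; the prefactor -8 therefore becomes -4.\<close>

lemma Q_n0_eq:
  assumes n: "n \<ge> 2"
  shows "Q_n0 n z = of_real (- 4 * pot n ((cmod z)\<^sup>2))"
proof -
  obtain m where m: "n = Suc (Suc m)" using n by (metis add_2_eq_Suc le_Suc_ex)
  define s where "s = (cmod z)\<^sup>2"
  define a where "a = s ^ Suc (Suc m)"
  define N where "N = real (Suc (Suc m))"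
  have s: "0 \<le> s" by (simp add: s_def)
  have a: "0 < 1 + a" using zero_le_power[OF s, of "Suc (Suc m)"] by (simp only: a_def)
  have "dz (dzbar (\<lambda>w. of_real (ln (1 + cmod w ^ (2 * n))))) z =
      of_real (N * s ^ Suc m / (1 + a) +
        s * (N * ((N - 1) * s ^ m * (1 + a) - s ^ Suc m * (N * s ^ Suc m)) / (1 + a)\<^sup>2))"
    using dz_dzbar_radial[OF log_deriv[of _ "Suc m"] log_deriv2[of _ m], of z]
    by (simp only: m power_mult a_def N_def s_def) simp
  also have "N * s ^ Suc m / (1 + a) +
        s * (N * ((N - 1) * s ^ m * (1 + a) - s ^ Suc m * (N * s ^ Suc m)) / (1 + a)\<^sup>2) = pot n s / 2"
  proof -
    have "s * (N * ((N - 1) * s ^ m * (1 + a) - s ^ Suc m * (N * s ^ Suc m))) =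
       N * ((N - 1) * (s * s ^ m) * (1 + a) - (s * s ^ Suc m) * (N * s ^ Suc m))"
      by (simp only: right_diff_distrib mult_ac)
    also have "\<dots> = N * ((N - 1) * s ^ Suc m * (1 + a) - a * (N * s ^ Suc m))"
      by (simp add: a_def)
    finally have "N * s ^ Suc m / (1 + a) +
        s * (N * ((N - 1) * s ^ m * (1 + a) - s ^ Suc m * (N * s ^ Suc m)) / (1 + a)\<^sup>2) =
       N * s ^ Suc m / (1 + a) + N * ((N - 1) * s ^ Suc m * (1 + a) - a * (N * s ^ Suc m)) / (1 + a)\<^sup>2"
      by (simp only: times_divide_eq_right)
    also have "\<dots> = N\<^sup>2 * s ^ Suc m / (1 + a)\<^sup>2"
      using a by (simp add: divide_simps power2_eq_square del: power_Suc) (simp add: algebra_simps)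
    finally show ?thesis by (simp add: pot_def m N_def a_def)
  qed
  finally show ?thesis by (simp add: Q_n0_def s_def mult.commute)
qed

theorem corollary1p4:
  fixes n :: nat
  assumes "n \<ge> 3"
  shows "(\<forall>z. Q_n0 n z =
            complex_of_real (- (8 * (real n)\<^sup>2 * cmod z ^ (2 * (n - 1))) / (1 + cmod z ^ (2 * n))\<^sup>2))
         \<and> (\<exists>E::real. E < 0 \<and> eigenvalue (schrodinger (Q_n0 n)) (complex_of_real E))"
proof (intro conjI allI)
  from assms have n: "n \<ge> 2" by simp
  note Q = Q_n0_eq[OF n]
  show "Q_n0 n z =
      complex_of_real (- (8 * (real n)\<^sup>2 * cmod z ^ (2 * (n - 1))) / (1 + cmod z ^ (2 * n))\<^sup>2)" for z
    unfolding Q by (simp add: pot_def power_mult)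
  interpret attractive_well "pot n"
    "\<lambda>s. 2 * (real n)\<^sup>2 * ((real n - 1) * s ^ (n - 2) * (1 + s ^ n) - 2 * real n * (s ^ (n - 1))\<^sup>2) / (1 + s ^ n) ^ 3"
    "\<lambda>s. (1 - s ^ n) / (1 + s ^ n)" "\<lambda>s. - 2 * real n * s ^ (n - 1) / (1 + s ^ n)\<^sup>2" "2 * (real n)\<^sup>2"
    by (rule attractive_well_pot[OF n])
  show "\<exists>E::real. E < 0 \<and> eigenvalue (schrodinger (Q_n0 n)) (complex_of_real E)"
  proof (rule bound_state)
    fix l g g' g'' C
    assume b: "0 < l" "g 0 = 1" "continuous_on {0..} g''"
      "\<And>s. 0 \<le> s \<Longrightarrow> (g has_real_derivative g' s) (at s within {0..})"
      "\<And>s. 0 \<le> s \<Longrightarrow> (g' has_real_derivative g'' s) (at s within {0..})"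
      "\<And>s. 0 \<le> s \<Longrightarrow> g' s + s * g'' s = (l - pot n s) * g s"
      "\<And>s. 0 \<le> s \<Longrightarrow> \<bar>g s\<bar> \<le> C / (1 + s)\<^sup>2"
      "\<And>s. 0 \<le> s \<Longrightarrow> \<bar>g' s\<bar> \<le> C / (1 + s)\<^sup>2"
      "\<And>s. 0 \<le> s \<Longrightarrow> \<bar>g'' s\<bar> \<le> C / (1 + s)\<^sup>2"
    interpret radial_H2 g g' g'' C by unfold_locales (fact b)+
    have "eigenvalue (schrodinger (Q_n0 n)) (of_real (- 4 * l))"
      by (rule U_eigenfunction[OF b(6) _ Q]) (use b(2) in auto)
    then show ?thesis by (intro exI[of _ "- 4 * l"]) (use b(1) in auto)
  qed
qed

end
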